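(* Let $N,d\in\mathbb{N}$ with $N\ge2$ and $\rho_c=d\frac{N-1}{N+1}<2$, and let $\tau$ be chosen uniformly at random in $\mathcal{F}_F^-$, with $\mathfrak{H}=\mathfrak{H}(\tau)=|\tau|_{\mathfrak{s}}$ its homogeneity. As $\rho\searrow\rho_c$, one has $$\mathbb{E}(\mathfrak{H})=\mathcal{O}(\rho-\rho_c),\qquad \operatorname{Var}(\mathfrak{H})=\mathcal{O}\bigl((\rho-\rho_c)^2\bigr).$$ Furthermore, $\mathfrak{H}$ satisfies the large-deviation estimate $$-\lim_{\rho\searrow\rho_c}(\rho-\rho_c)\log\mathbb{P}\{\mathfrak{H}\le h\}=\frac{N+1}{N}\beta_N(-h)\qquad\forall h\in[\alpha_0,0].$$
   Context: Let $\rho\in(\rho_c,2]$, scaling $\mathfrak{s}=(\rho,1,\dots,1)$, $|k|_{\mathfrak{s}}=\rho k_0+k_1+\dots+k_d$ for $k\in\mathbb{N}_0^{d+1}$, and $\alpha_0=-\frac{\rho+d}{2}-\kappa$, where $\kappa>0$ is an arbitrarily small constant, assumed smaller than $\rho-\rho_c$ when the limit $\rho\searrow\rho_c$ is considered; $-\alpha_0$ converges to $Nd/(N+1)$ as $\rho\searrow\rho_c$. Formal symbols are built from $\mathbf{1}$, $X_0,\dots,X_d$, $\Xi$ by a commutative associative product with unit $\mathbf{1}$ and a unary operation $\mathcal{I}_\rho$; $X^k=X_0^{k_0}\cdots X_d^{k_d}$. By convention $\mathcal{I}_\rho(X^k)=0$ for all $k$ (in particular $\mathcal{I}_\rho(\mathbf{1})=0$),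 and $0$ is not listed as a symbol. Set $\mathcal{W}_0=\mathcal{U}_0=\emptyset$ and, for $m\ge1$, $$\mathcal{W}_m=\mathcal{W}_{m-1}\cup\{\Xi\}\cup\bigcup_{n=1}^N\{\tau_1\cdots\tau_n:\tau_i\in\mathcal{U}_{m-1}\},\qquad \mathcal{U}_m=\{X^k:k\in\mathbb{N}_0^{d+1}\}\cup\{\mathcal{I}_\rho(\tau):\tau\in\mathcal{W}_m\},$$ and $\mathcal{F}_F=\bigcup_{m\ge0}(\mathcal{W}_m\cup\mathcal{U}_m)$. The homogeneity is defined by $|\Xi|_{\mathfrak{s}}=\alpha_0$, $|X^k|_{\mathfrak{s}}=|k|_{\mathfrak{s}}$, $|\mathcal{I}_\rho(\tau)|_{\mathfrak{s}}=|\tau|_{\mathfrak{s}}+\rho$, $|\tau\bar\tau|_{\mathfrak{s}}=|\tau|_{\mathfrak{s}}+|\bar\tau|_{\mathfrak{s}}$. The set $\mathcal{F}_F^-=\{\tau\in\mathcal{F}_F:|\tau|_{\mathfrak{s}}<0\}$ is endowed with the uniform probability measure $\mathbb{P}$, with expectation $\mathbb{E}$ and variance $\operatorname{Var}$. (These are the symbols for the SPDE $\partial_tu=\Delta^{\rho/2}u+f(u)+\xi$ on $\mathbb{T}^d$, $f$ a polynomial of degree $N$, $\xi$ space-time white noise.) The constant is $\beta_N=\frac{2N^2}{(N+1)^2}\log(\alpha_N^{-1})$, where $\alpha_N$ (for $N\ge2$; not to be confused with $\alpha_0$) is as follows. For $N=2$, $\alpha_2\approx0.4026975$ is the radius of convergence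 of $\sum_nw_nx^n$, with $w_n$ the Wedderburn--Etherington number, i.e. the number of non-homeomorphic (unordered) rooted binary trees with $n$ leaves (each non-leaf vertex having exactly two children); thus $\beta_2=\frac89\log(\alpha_2^{-1})\approx0.8085063$. For $N>2$, let $w_n^{(N)}$ be the number of non-homeomorphic (unordered) regular trees of degree $N$ (rooted trees in which each vertex except the leaves has exactly $N$ children) with $n$ vertices, as analysed by Otter (The number of trees, 1948), with asymptotics $w_n^{(N)}\sim c_N(\alpha_N^{-1})^n/n^{3/2}$, $\alpha_N$ being the radius of convergence of the generating series; in particular $\alpha_3\approx0.3551817$ and $\beta_3\approx1.164517$.
   Formalization: For N=2, α_2 is the radius counting trees by vertices, i.e. the square root of 0.4026975 (α_3 likewise the cube root of 0.3551817): the printed values fail by a factor N. κ depends on ρ, is small enough that the set of negative symbols is finite, and is o(ρ−ρ_c) for the large deviations. *)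

theory Defs
  imports "HOL-Probability.Probability" "HOL-Library.Landau_Symbols"
begin

section \<open>Symbols\<close>

text \<open>
  Formal symbols form the free commutative monoid over the factors \<open>X\<^sub>i\<close>, \<open>\<Xi>\<close> and \<open>\<I>(\<tau>)\<close>, that is, the
  multisets of such factors: the unit \<open>\<one>\<close> is \<open>{#}\<close> and the product of symbols is multiset addition.
\<close>

datatype factor = X nat | Noise | Integ "factor multiset"

type_synonym symbol = "factor multiset"

definition Xi :: symbol where
  "Xi = {#Noise#}"

definition I_op :: "symbol \<Rightarrow> symbol" where
  "I_op \<tau> = {#Integ \<tau>#}"

text \<open>Only the components \<open>k 0, \<dots>, k d\<close> of the multi-index are used.\<close>

definition X_pow :: "nat \<Rightarrow> (nat \<Rightarrow> nat) \<Rightarrow> symbol" where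
  "X_pow d k = (\<Sum>i\<le>d. replicate_mset (k i) (X i))"

text \<open>
  Since \<open>\<I>(X\<^sup>k) = 0\<close> and \<open>0\<close> is not listed as a symbol, \<open>\<I>\<close> is applied only to symbols that are not
  of the form \<open>X\<^sup>k\<close>.
\<close>

fun sym_W :: "nat \<Rightarrow> nat \<Rightarrow> nat \<Rightarrow> symbol set"
  and sym_U :: "nat \<Rightarrow> nat \<Rightarrow> nat \<Rightarrow> symbol set" where
  "sym_W N d 0 = {}"
| "sym_W N d (Suc m) = sym_W N d m \<union> {Xi} \<union>
     (\<Union>n\<in>{1..N}. {(\<Sum>i<n. \<tau> i) |\<tau>. \<forall>i<n. \<tau> i \<in> sym_U N d m})"
| "sym_U N d 0 = {}"
| "sym_U N d (Suc m) = range (X_pow d) \<union>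
     {I_op \<tau> |\<tau>. \<tau> \<in> sym_W N d (Suc m) \<and> \<tau> \<notin> range (X_pow d)}"

definition F_F :: "nat \<Rightarrow> nat \<Rightarrow> symbol set" where
  "F_F N d = (\<Union>m. sym_W N d m \<union> sym_U N d m)"


section \<open>Homogeneity\<close>

definition rho_c :: "nat \<Rightarrow> nat \<Rightarrow> real" where
  "rho_c N d = real d * (real N - 1) / (real N + 1)"

definition alpha0 :: "nat \<Rightarrow> real \<Rightarrow> real \<Rightarrow> real" where
  "alpha0 d \<rho> \<kappa> = - (\<rho> + real d) / 2 - \<kappa>"

primrec factor_hom :: "nat \<Rightarrow> real \<Rightarrow> real \<Rightarrow> factor \<Rightarrow> real" where
  "factor_hom d \<rho> \<kappa> (X i) = (if i = 0 then \<rho> else 1)"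
| "factor_hom d \<rho> \<kappa> Noise = alpha0 d \<rho> \<kappa>"
| "factor_hom d \<rho> \<kappa> (Integ \<tau>) = sum_mset (image_mset (factor_hom d \<rho> \<kappa>) \<tau>) + \<rho>"

definition hom :: "nat \<Rightarrow> real \<Rightarrow> real \<Rightarrow> symbol \<Rightarrow> real" where
  "hom d \<rho> \<kappa> \<tau> = sum_mset (image_mset (factor_hom d \<rho> \<kappa>) \<tau>)"

lemma hom_Xi: "hom d \<rho> \<kappa> Xi = alpha0 d \<rho> \<kappa>"
  by (simp add: hom_def Xi_def)

lemma hom_I_op: "hom d \<rho> \<kappa> (I_op \<tau>) = hom d \<rho> \<kappa> \<tau> + \<rho>"
  by (simp add: hom_def I_op_def)

lemma hom_mult: "hom d \<rho> \<kappa> (\<sigma> + \<tau>) = hom d \<rho> \<kappa> \<sigma> + hom d \<rho> \<kappa> \<tau>"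
  by (simp add: hom_def)

lemma hom_X_pow: "hom d \<rho> \<kappa> (X_pow d k) = \<rho> * real (k 0) + (\<Sum>i=1..d. real (k i))"
proof -
  have "hom d \<rho> \<kappa> (\<Sum>i\<le>n. replicate_mset (k i) (X i)) = \<rho> * real (k 0) + (\<Sum>i=1..n. real (k i))" for n
    by (induction n) (simp_all add: hom_def)
  then show ?thesis
    by (simp add: X_pow_def)
qed

definition F_neg :: "nat \<Rightarrow> nat \<Rightarrow> real \<Rightarrow> real \<Rightarrow> symbol set" where
  "F_neg N d \<rho> \<kappa> = {\<tau> \<in> F_F N d. hom d \<rho> \<kappa> \<tau> < 0}"

text \<open>Meaningful only when the set of negative symbols is finite (local subcriticality).\<close>

definition unif_neg :: "nat \<Rightarrow> nat \<Rightarrow> real \<Rightarrow> real \<Rightarrow> symbol pmf" where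
  "unif_neg N d \<rho> \<kappa> = pmf_of_set (F_neg N d \<rho> \<kappa>)"


section \<open>Regular trees and the constant \<open>\<beta>\<^sub>N\<close>\<close>

datatype rtree = Node "rtree multiset"

primrec regular :: "nat \<Rightarrow> rtree \<Rightarrow> bool" where
  "regular N (Node ts) \<longleftrightarrow>
     (size ts = 0 \<or> size ts = N) \<and> (\<forall>b \<in># image_mset (regular N) ts. b)"

primrec vertices :: "rtree \<Rightarrow> nat" where
  "vertices (Node ts) = Suc (sum_mset (image_mset vertices ts))"

definition num_regular :: "nat \<Rightarrow> nat \<Rightarrow> nat" where
  "num_regular N n = card {t. regular N t \<and> vertices t = n}"

text \<open>
  All vertices are counted, leaves included, for every \<open>N \<ge> 2\<close>. A regular tree with \<open>m\<close> inner vertices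
  has \<open>N m + 1\<close> vertices and \<open>(N - 1) m + 1\<close> leaves, so the radius of the series that counts inner
  vertices is \<open>\<alpha>\<^sub>N\<^sup>N\<close>: it is 0.40269\<dots> for \<open>N = 2\<close> (the Wedderburn--Etherington numbers, where counting
  leaves gives the same radius) and 0.35518\<dots> for \<open>N = 3\<close>.
\<close>

definition alpha_reg :: "nat \<Rightarrow> real" where
  "alpha_reg N = real_of_ereal (conv_radius (\<lambda>n. real (num_regular N n)))"

definition beta :: "nat \<Rightarrow> real" where
  "beta N = 2 * (real N)\<^sup>2 / (real N + 1)\<^sup>2 * ln (1 / alpha_reg N)"

end

theory Submission
  imports Defs
begin

text \<open>
  Put \<open>\<delta> = N (\<alpha>\<^sub>0 + \<rho>) - \<alpha>\<^sub>0 = (N + 1) / 2 (\<rho> - \<rho>\<^sub>c) - (N - 1) \<kappa>\<close>. A symbol that is a regular tree with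
  \<open>m\<close> inner vertices and all its leaves \<open>\<Xi>\<close> has homogeneity \<open>\<alpha>\<^sub>0 + m \<delta>\<close>. Every missing child and every
  factor \<open>X\<^sub>i\<close> costs an amount of homogeneity bounded from below, so that a symbol of negative
  homogeneity arises from a regular tree by a bounded number of modifications. Hence, up to a factor
  polynomial in \<open>m\<close>, the symbols of homogeneity at most \<open>h\<close> are as numerous as the regular trees with
  \<open>m = (h - \<alpha>\<^sub>0) / \<delta>\<close> inner vertices, whose number has exponential growth rate \<open>N log (1 / \<alpha>\<^sub>N)\<close>; this
  gives the large deviations. For the moments no such asymptotics is needed (a polynomial factor would
  even cost a logarithm): grafting operations embed two disjoint copies of the set of symbols of
  homogeneity below \<open>- 2 \<delta>\<close>, shifted by \<open>2 \<delta>\<close>, into the set of negative symbols, so the distribution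
  of the homogeneity has geometric tails at scale \<open>\<delta>\<close>.
\<close>


section \<open>Counting regular trees\<close>

lemma rtree_regular_simps [simp]:
  "regular N (Node ts) \<longleftrightarrow> (ts = {#} \<or> size ts = N) \<and> (\<forall>t\<in>#ts. regular N t)"
  by auto

declare regular.simps [simp del]

definition reg_trees :: "nat \<Rightarrow> nat \<Rightarrow> rtree set" where
  "reg_trees N n = {t. regular N t \<and> vertices t = n}"

text \<open>
  A stack machine reading regular trees in postfix notation: the code of a tree has one bit per
  vertex, so there are at most \<open>2\<^sup>n\<close> trees with \<open>n\<close> vertices and the radius \<open>\<alpha>\<^sub>N\<close> is positive.
\<close>

fun run :: "nat \<Rightarrow> bool list \<Rightarrow> rtree list \<Rightarrow> rtree list" where
  "run N [] st = st"
| "run N (b # w) st =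
     run N w (if b then Node (mset (take N st)) # drop N st else Node {#} # st)"

lemma run_append: "run N (v @ w) st = run N w (run N v st)"
  by (induction N v st rule: run.induct) auto

text \<open>The codes of the children are concatenated and one letter \<open>True\<close> for the
  root is appended. Quantifying over all stacks is what makes concatenation work.\<close>

lemma regular_code:
  "regular N t \<Longrightarrow> \<exists>w. length w = vertices t \<and> (\<forall>st. run N w st = t # st)"
proof (induction t)
  case (Node ts)
  show ?case
  proof (cases "ts = {#}")
    case True
    then show ?thesis by (intro exI[of _ "[False]"]) simp
  next
    case False
    with Node.prems have N: "size ts = N" and reg: "\<forall>t\<in>#ts. regular N t" by auto
    \<comment> \<open>Each child is pushed onto the stack, so a list of children ends up reversed;
      \<open>mset\<close> forgets the order later.\<close>
    have codes: "\<exists>w. length w = sum_list (map vertices xs) \<and> (\<forall>st. run N w st = rev xs @ st)"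
      if "set xs \<subseteq> set_mset ts" for xs
      using that
    proof (induction xs)
      case Nil
      then show ?case by simp
    next
      case (Cons x xs)
      then obtain w where w: "length w = sum_list (map vertices xs)" "\<And>st. run N w st = rev xs @ st"
        by auto
      from Cons.prems Node.IH reg obtain v where v: "length v = vertices x" "\<And>st. run N v st = x # st"
        by (meson in_mono list.set_intros(1))
      from v w show ?case by (intro exI[of _ "v @ w"]) (simp add: run_append)
    qed
    obtain xs where xs: "mset xs = ts" using ex_mset by blast
    then obtain w where w: "length w = sum_list (map vertices xs)" "\<And>st. run N w st = rev xs @ st"
      using codes[of xs] by auto
    have len: "length xs = N" using xs N by auto
    have "sum_mset (image_mset vertices ts) = sum_list (map vertices xs)"
      using xs by (metis mset_map sum_mset_sum_list)
    then show ?thesis using w len xs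
      by (intro exI[of _ "w @ [True]"]) (auto simp: run_append)
  qed
qed

text \<open>A tree is the head of the stack that its code leaves when started on the empty stack, so
  there are at most as many trees as words of length \<open>n\<close>.\<close>

lemma reg_trees_finite_card: "finite (reg_trees N n) \<and> card (reg_trees N n) \<le> 2 ^ n"
proof -
  have sub: "reg_trees N n \<subseteq> (\<lambda>w. hd (run N w [])) ` {w. set w \<subseteq> UNIV \<and> length w = n}"
    using regular_code by (force simp: reg_trees_def image_iff)
  have fin: "finite {w :: bool list. set w \<subseteq> UNIV \<and> length w = n}"
    by (rule finite_lists_length_eq) simp
  have "card {w :: bool list. set w \<subseteq> UNIV \<and> length w = n} = 2 ^ n"
    by (subst card_lists_length_eq) auto
  then show ?thesis
    using sub fin by (metis (no_types, lifting) card_image_le card_mono finite_imageI finite_subset order_trans)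
qed

lemmas finite_reg_trees = reg_trees_finite_card[THEN conjunct1]

lemma num_regular_eq: "num_regular N n = card (reg_trees N n)"
  by (simp add: num_regular_def reg_trees_def)

lemma num_regular_le: "num_regular N n \<le> 2 ^ n"
  using reg_trees_finite_card by (simp add: num_regular_eq)

section \<open>Counting by the number of inner vertices\<close>

text \<open>Every vertex other than the root is one of the \<open>N\<close> children of an inner
  vertex; \<open>m\<close> is the number of inner vertices.\<close>

lemma vertices_regular:
  assumes "regular N t"
  shows "\<exists>m. vertices t = N * m + 1"
  using assms
proof (induction t)
  case (Node ts)
  have "\<exists>m. sum_mset (image_mset vertices us) = N * m + size us" if "us \<subseteq># ts" for us
    using that
  proof (induction us)
    case empty
    then show ?case by simp
  next
    case (add u us)
    then obtain m where "sum_mset (image_mset vertices us) = N * m + size us"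
      using subset_mset.order_trans[of us "add_mset u us" ts] by auto
    moreover obtain k where "vertices u = N * k + 1"
      using Node add.prems by (metis insert_subset_eq_iff rtree_regular_simps)
    ultimately show ?case by (intro exI[of _ "m + k"]) (simp add: algebra_simps)
  qed
  from this[of ts] obtain m where m: "sum_mset (image_mset vertices ts) = N * m + size ts" by auto
  show ?case
  proof (cases "ts = {#}")
    case False
    then show ?thesis using m Node.prems by (intro exI[of _ "Suc m"]) auto
  qed (auto intro!: exI[of _ 0])
qed

definition inner_count :: "nat \<Rightarrow> nat \<Rightarrow> nat" where
  "inner_count N m = num_regular N (N * m + 1)"

text \<open>Placing a tree below a new root, next to \<open>N - 1\<close> leaves, is injective and
  adds one inner vertex.\<close>

lemma inner_count_mono:
  assumes "N \<ge> 1"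
  shows "mono (inner_count N)"
proof (rule mono_iff_le_Suc[THEN iffD2], rule allI)
  fix m
  let ?f = "\<lambda>t. Node (add_mset t (replicate_mset (N - 1) (Node {#})))"
  have "inj_on ?f (reg_trees N (N * m + 1))" by (auto intro: inj_onI)
  moreover have "?f ` reg_trees N (N * m + 1) \<subseteq> reg_trees N (N * Suc m + 1)"
    using assms by (auto simp: reg_trees_def)
  ultimately show "inner_count N m \<le> inner_count N (Suc m)"
    unfolding inner_count_def num_regular_eq using finite_reg_trees card_inj_on_le by blast
qed

lemma inner_count_pos:
  assumes "N \<ge> 1"
  shows "inner_count N m \<ge> 1"
proof -
  have "Node {#} \<in> reg_trees N (N * 0 + 1)" by (simp add: reg_trees_def)
  then have "inner_count N 0 \<ge> 1" unfolding inner_count_def num_regular_eq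
    using finite_reg_trees by (metis One_nat_def Suc_leI card_gt_0_iff empty_iff)
  then show ?thesis using inner_count_mono[OF assms] monoD[of "inner_count N" 0 m] by simp
qed

text \<open>Two trees are joined below a new root, padded with \<open>N - 2\<close> leaves. The new
  root is the \<open>+ 1\<close>. The factor 2 appears because children are unordered, so that a
  joined tree comes from at most two pairs.\<close>

lemma inner_count_supermult:
  assumes "N \<ge> 2"
  shows "inner_count N m * inner_count N n \<le> 2 * inner_count N (m + n + 1)"
proof -
  let ?A = "reg_trees N (N * m + 1) \<times> reg_trees N (N * n + 1)"
  let ?f = "\<lambda>(s, t). Node ({#s, t#} + replicate_mset (N - 2) (Node {#}))"
  have fin: "finite ?A" by (simp add: finite_reg_trees)
  have sub: "?f ` ?A \<subseteq> reg_trees N (N * (m + n + 1) + 1)"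
    using assms by (auto simp: reg_trees_def algebra_simps)
  have fiber: "card {p \<in> ?A. ?f p = y} \<le> 2" if "y \<in> ?f ` ?A" for y
  proof -
    from that obtain s t where y: "y = ?f (s, t)" by auto
    have swap: "{#a, b#} = {#s, t#} \<Longrightarrow> (a, b) \<in> {(s, t), (t, s)}" for a b
      unfolding add_eq_conv_diff[of a "{#b#}"] by (auto split: if_splits)
    have "p \<in> {(s, t), (t, s)}" if "?f p = y" for p
    proof -
      obtain a b where p: "p = (a, b)" by (cases p)
      have "{#a, b#} = {#s, t#}"
        using that unfolding p y prod.case rtree.inject add_right_cancel .
      then show ?thesis unfolding p by (rule swap)
    qed
    then have "{p \<in> ?A. ?f p = y} \<subseteq> {(s, t), (t, s)}" by blast
    then have "card {p \<in> ?A. ?f p = y} \<le> card {(s, t), (t, s)}" by (rule card_mono[rotated]) simp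
    also have "\<dots> \<le> Suc (Suc 0)"
      using card_insert_le_m1[of 2 "{(t, s)}" "(s, t)"] by simp
    finally show ?thesis by simp
  qed
  have "card ?A = (\<Sum>y\<in>?f ` ?A. card {p \<in> ?A. ?f p = y})"
    using sum.image_gen[OF fin, of "\<lambda>_. 1::nat" ?f] by simp
  also have "\<dots> \<le> (\<Sum>y\<in>?f ` ?A. 2)" by (intro sum_mono fiber)
  also have "\<dots> = 2 * card (?f ` ?A)" by simp
  also have "\<dots> \<le> 2 * card (reg_trees N (N * (m + n + 1) + 1))"
    using card_mono[OF finite_reg_trees sub] by simp
  finally show ?thesis by (simp add: inner_count_def num_regular_eq card_cartesian_product)
qed

section \<open>Exponential growth rate of the number of regular trees\<close>

text \<open>Inside the disc of convergence the terms of the series are bounded; those of index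
  \<open>N * m + 1\<close> give the estimate.\<close>

lemma inner_count_upper:
  assumes "0 < x" "ereal x < conv_radius (\<lambda>n. real (num_regular N n))"
  shows "\<exists>C>0. \<forall>m. real (inner_count N m) \<le> C * (1 / x ^ N) ^ m"
proof -
  have "summable (\<lambda>n. real (num_regular N n) * x ^ n)"
    using assms by (intro summable_in_conv_radius) simp
  then have "Bseq (\<lambda>n. real (num_regular N n) * x ^ n)"
    by (intro convergent_imp_Bseq) (auto dest: summable_LIMSEQ_zero simp: convergent_def)
  then obtain K where K: "K > 0" "\<And>n. real (num_regular N n) * x ^ n \<le> K"
    by (auto simp: Bseq_def) (metis abs_le_D1)
  have "real (inner_count N m) \<le> K / x * (1 / x ^ N) ^ m" for m
    using K(2)[of "N * m + 1"] assms(1)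
    by (simp add: inner_count_def field_simps power_mult power_add)
  then show ?thesis using K(1) assms(1) by (intro exI[of _ "K / x"]) auto
qed

text \<open>Supermultiplicativity turns one good value of the sequence into a lower bound for all of it.\<close>

lemma inner_count_power:
  assumes "N \<ge> 2"
  shows "(real (inner_count N k) / 2) ^ j \<le> real (inner_count N (j * (k + 1) + r))"
proof (induction j)
  case 0
  then show ?case using inner_count_pos[of N r] assms by simp
next
  case (Suc j)
  have "(real (inner_count N k) / 2) ^ Suc j
      \<le> real (inner_count N k) / 2 * real (inner_count N (j * (k + 1) + r))"
    using Suc by (simp add: mult_left_mono)
  also have "\<dots> = real (inner_count N k * inner_count N (j * (k + 1) + r)) / 2" by simp
  also have "\<dots> \<le> real (2 * inner_count N (k + (j * (k + 1) + r) + 1)) / 2"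
    using inner_count_supermult[OF assms] by (intro divide_right_mono) (simp_all only: of_nat_le_iff)
  finally show ?case by (simp add: algebra_simps)
qed

lemma num_regular_eq_0:
  assumes "\<And>m. n \<noteq> N * m + 1"
  shows "num_regular N n = 0"
proof -
  have "{t. regular N t \<and> vertices t = n} = {}" using assms vertices_regular by fastforce
  then show ?thesis unfolding num_regular_def by (simp only: card.empty)
qed

text \<open>Were the terms at \<open>y\<close> bounded, the series would converge beyond its radius.
  So some \<open>k\<close> has a count large enough to absorb the factor 2 of supermultiplicativity,
  and iterating this \<open>k\<close> yields the rate.\<close>

lemma inner_count_lower:
  assumes N: "N \<ge> 2" and y: "conv_radius (\<lambda>n. real (num_regular N n)) < ereal y" "y > 0"
  shows "\<exists>C>0. \<forall>m. real (inner_count N m) \<ge> C * (1 / y ^ N) ^ m"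
proof (cases "y \<ge> 1")
  case True
  have "real (inner_count N m) \<ge> 1 * (1 / y ^ N) ^ m" for m
  proof -
    have "(1 / y ^ N) ^ m \<le> 1"
      using True by (intro power_le_one) auto
    then show ?thesis using inner_count_pos[of N m] N
      by (metis (mono_tags, opaque_lifting) dual_order.trans mult_1 numeral_le_one_iff
          nat_le_linear of_nat_1 of_nat_le_iff semiring_norm(69))
  qed
  then show ?thesis by (intro exI[of _ 1]) auto
next
  case False
  \<comment> \<open>This threshold makes half of the count at \<open>k\<close> at least
    \<open>q ^ (k + 1)\<close>: the 2 compensates the loss in supermultiplicativity, the division by
    \<open>y ^ N\<close> the additional root.\<close>
  define B where "B = 2 / y ^ N"
  have "\<exists>k. real (inner_count N k) * y ^ (N * k + 1) > B"
  proof (rule ccontr)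
    assume "\<not> ?thesis"
    then have le: "real (inner_count N k) * y ^ (N * k + 1) \<le> B" for k
      by (auto simp: not_less)
    have B: "B > 0" using y by (simp add: B_def)
    have bd: "real (num_regular N n) * y ^ n \<le> B" for n
    proof (cases "\<exists>m. n = N * m + 1")
      case True
      then show ?thesis using le by (auto simp: inner_count_def)
    next
      case False
      then show ?thesis using num_regular_eq_0[of n N] B by auto
    qed
    \<comment> \<open>A point strictly between the radius and \<open>y\<close>: bounded terms at
      \<open>y\<close> would give geometric convergence at \<open>x\<close>.\<close>
    obtain x where x: "conv_radius (\<lambda>n. real (num_regular N n)) < ereal x" "ereal x < ereal y"
      using ereal_dense2 y(1) by blast
    have x0: "x > 0" using x(1) conv_radius_nonneg[of "\<lambda>n. real (num_regular N n)"]
      by (metis ereal_less(2) order_le_less_trans)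
    have "summable (\<lambda>n. real (num_regular N n) * x ^ n)"
    proof (rule summable_comparison_test')
      show "summable (\<lambda>n. B * (x / y) ^ n)"
        using x x0 y by (intro summable_mult summable_geometric) auto
      show "norm (real (num_regular N n) * x ^ n) \<le> B * (x / y) ^ n" for n
        using mult_right_mono[OF bd[of n], of "(x / y) ^ n"] x0 y by (simp add: power_divide)
    qed
    then have "ereal (norm x) \<le> conv_radius (\<lambda>n. real (num_regular N n))"
      by (rule conv_radius_geI)
    then show False using x x0 by simp
  qed
  then obtain k where k: "real (inner_count N k) * y ^ (N * k + 1) > B" by blast
  define q where "q = 1 / y ^ N"
  have q: "q \<ge> 1" using False y by (simp add: q_def power_le_one)
  have "y ^ (N * k + 1) \<le> y ^ (N * k)" using False y by (simp add: mult_left_le_one_le)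
  then have "real (inner_count N k) * y ^ (N * k) \<ge> B"
    using k by (meson dual_order.trans less_imp_le mult_left_mono of_nat_0_le_iff)
  then have k2: "real (inner_count N k) / 2 \<ge> q ^ (k + 1)"
    using y by (simp add: q_def B_def field_simps power_mult power_add)
  have "real (inner_count N m) \<ge> 1 / q ^ (k + 1) * q ^ m" for m
  proof -
    \<comment> \<open>\<open>m\<close> consists of \<open>j\<close> blocks of \<open>k + 1\<close>
      inner vertices and a remainder, which is absorbed in the constant
      \<open>1 / q ^ (k + 1)\<close>.\<close>
    define j r where "j = m div (k + 1)" and "r = m mod (k + 1)"
    have m: "m = j * (k + 1) + r" unfolding j_def r_def by (rule div_mult_mod_eq[symmetric])
    have r: "r \<le> k + 1" unfolding r_def by (intro less_imp_le mod_less_divisor) simp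
    have "q ^ m \<le> q ^ (j * (k + 1) + (k + 1))" using q r m by (intro power_increasing) auto
    also have "\<dots> = (q ^ (k + 1)) ^ j * q ^ (k + 1)"
      by (simp only: power_add mult.commute[of j] power_mult)
    also have "\<dots> \<le> (real (inner_count N k) / 2) ^ j * q ^ (k + 1)"
      using k2 q by (intro mult_right_mono power_mono) auto
    also have "\<dots> \<le> real (inner_count N m) * q ^ (k + 1)"
      using inner_count_power[OF N, of k j r] q unfolding m by (intro mult_right_mono) auto
    finally show ?thesis using q by (simp add: field_simps)
  qed
  then show ?thesis using q unfolding q_def[symmetric]
    by (intro exI[of _ "1 / q ^ (k + 1)"] conjI allI) (simp, blast)
qed

text \<open>\<open>real_of_ereal\<close> maps infinity to 0, so \<open>alpha_reg\<close> is the
  radius only once the radius is known to be finite. It is at least 1/4 by the bound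
  \<open>2 ^ n\<close>, and at most 1 because the coefficients of index \<open>N * m + 1\<close> are
  at least 1.\<close>

lemma conv_radius_num_regular:
  assumes "N \<ge> 2"
  shows "conv_radius (\<lambda>n. real (num_regular N n)) = ereal (alpha_reg N)" "alpha_reg N > 0"
proof -
  let ?R = "conv_radius (\<lambda>n. real (num_regular N n))"
  have "summable (\<lambda>n. real (num_regular N n) * (1/4) ^ n)"
  proof (rule summable_comparison_test')
    show "summable (\<lambda>n. (1/2::real) ^ n)" by (intro summable_geometric) auto
    show "norm (real (num_regular N n) * (1/4) ^ n) \<le> (1/2) ^ n" for n
    proof -
      have "real (num_regular N n) \<le> 2 ^ n"
        using num_regular_le by (metis of_nat_le_iff of_nat_numeral of_nat_power)
      then have "real (num_regular N n) * (1/4) ^ n \<le> 2 ^ n * (1/4) ^ n"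
        by (intro mult_right_mono) auto
      also have "\<dots> = (1/2) ^ n" by (simp flip: power_mult_distrib)
      finally show ?thesis by simp
    qed
  qed
  then have lower: "?R \<ge> ereal (norm (1/4::real))" by (rule conv_radius_geI)
  have "?R \<le> ereal (norm (1::real))"
  proof (rule conv_radius_leI', rule notI)
    assume "summable (\<lambda>n. real (num_regular N n) * 1 ^ n)"
    then have "(\<lambda>n. real (num_regular N n)) \<longlonglongrightarrow> 0" by (simp add: summable_LIMSEQ_zero)
    then have "\<forall>\<^sub>F n in sequentially. real (num_regular N n) < 1"
      by (rule order_tendstoD) simp
    then obtain n0 where "\<And>n. n \<ge> n0 \<Longrightarrow> real (num_regular N n) < 1"
      by (auto simp: eventually_sequentially)
    moreover have "N * n0 + 1 \<ge> n0" using assms by (cases N) auto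
    ultimately have "real (inner_count N n0) < 1" by (simp add: inner_count_def)
    then show False using inner_count_pos[of N n0] assms by simp
  qed
  with lower have "?R = ereal (real_of_ereal ?R)" by (intro ereal_real'[symmetric]) auto
  then show 1: "?R = ereal (alpha_reg N)" by (simp add: alpha_reg_def)
  show "alpha_reg N > 0" using lower unfolding 1 by simp
qed

text \<open>Exponential rate per inner vertex, each of which accounts for \<open>N\<close>
  vertices.\<close>

definition growth_rate :: "nat \<Rightarrow> real" where
  "growth_rate N = real N * ln (1 / alpha_reg N)"

text \<open>The upper and lower bounds are applied at the radius times \<open>exp (- \<eta>)\<close>
  and times \<open>exp \<eta>\<close>, on either side of the circle of convergence.\<close>

lemma ln_inner_count:
  assumes N: "N \<ge> 2" and \<epsilon>: "\<epsilon> > 0"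
  shows "\<exists>C. \<forall>m. \<bar>ln (real (inner_count N m)) - growth_rate N * real m\<bar> \<le> \<epsilon> * real m + C"
proof -
  \<comment> \<open>The radius enters with the power \<open>N\<close> per inner vertex, so its
    perturbation is divided by \<open>N\<close>.\<close>
  define \<eta> where "\<eta> = \<epsilon> / real N"
  have \<eta>: "\<eta> > 0" using N \<epsilon> by (simp add: \<eta>_def)
  note R = conv_radius_num_regular[OF N]
  have pow: "ln (C * (1 / (alpha_reg N * exp z) ^ N) ^ m)
      = ln C + growth_rate N * real m - z * real N * real m" if "C > 0" for C z :: real and m :: nat
    using that R(2) by (simp add: ln_mult ln_div ln_realpow growth_rate_def algebra_simps)
  have "alpha_reg N * exp (- \<eta>) < alpha_reg N * 1" "alpha_reg N * 1 < alpha_reg N * exp \<eta>"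
    using R(2) \<eta> by (intro mult_strict_left_mono; simp)+
  then obtain C1 C2 where C: "C1 > 0" "C2 > 0"
    "\<And>m. real (inner_count N m) \<le> C1 * (1 / (alpha_reg N * exp (- \<eta>)) ^ N) ^ m"
    "\<And>m. real (inner_count N m) \<ge> C2 * (1 / (alpha_reg N * exp \<eta>) ^ N) ^ m"
    using inner_count_upper[of "alpha_reg N * exp (- \<eta>)" N]
      inner_count_lower[OF N, of "alpha_reg N * exp \<eta>"] R by fastforce
  have "\<bar>ln (real (inner_count N m)) - growth_rate N * real m\<bar>
      \<le> \<epsilon> * real m + (\<bar>ln C1\<bar> + \<bar>ln C2\<bar>)" for m
  proof -
    have pos: "real (inner_count N m) > 0" using inner_count_pos[of N m] N by simp
    have "ln (real (inner_count N m)) \<le> ln C1 + growth_rate N * real m - (- \<eta>) * real N * real m"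
      using C(3)[of m] pos by (subst pow[OF C(1), symmetric]) simp
    moreover have "ln (real (inner_count N m)) \<ge> ln C2 + growth_rate N * real m - \<eta> * real N * real m"
      using C(4)[of m] C(2) R(2) by (subst pow[OF C(2), symmetric], intro ln_mono) auto
    moreover have "\<eta> * real N = \<epsilon>" using N by (simp add: \<eta>_def)
    ultimately show ?thesis by (auto simp: abs_le_iff)
  qed
  then show ?thesis by blast
qed

section \<open>Symbols and regular trees\<close>

lemma sym_W_mono: "m \<le> m' \<Longrightarrow> sym_W N d m \<subseteq> sym_W N d m'"
  by (rule lift_Suc_mono_le) auto

text \<open>An element of \<open>sym_U\<close> is a product with a single factor; hence
  \<open>F_F\<close> is the union of the sets \<open>sym_W\<close> alone.\<close>

lemma sym_U_subset_sym_W: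
  assumes "N \<ge> 1"
  shows "sym_U N d m \<subseteq> sym_W N d (Suc m)"
proof
  fix \<tau> assume "\<tau> \<in> sym_U N d m"
  then have "\<tau> \<in> {(\<Sum>i<1. \<tau> i) |\<tau>. \<forall>i<1::nat. \<tau> i \<in> sym_U N d m}"
    by (intro CollectI exI[of _ "\<lambda>_. \<tau>"]) auto
  then show "\<tau> \<in> sym_W N d (Suc m)"
    using assms unfolding sym_W.simps by (intro UnI2 UN_I[of 1]) auto
qed

lemma F_F_eq:
  assumes "N \<ge> 1"
  shows "F_F N d = (\<Union>m. sym_W N d m)"
  using sym_U_subset_sym_W[OF assms] unfolding F_F_def by blast

lemma Integ_notin_X_pow: "Integ \<sigma> \<notin># X_pow d k"
  by (simp add: X_pow_def set_mset_sum)

text \<open>The symbols to which \<open>I_op\<close> may be applied. For positive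
  \<open>\<rho>\<close> they include all symbols of negative homogeneity, since monomials have
  nonnegative homogeneity.\<close>

definition proper :: "nat \<Rightarrow> nat \<Rightarrow> symbol set" where
  "proper N d = F_F N d - range (X_pow d)"

lemma Xi_proper: "Xi \<in> proper N d"
proof -
  have "Xi \<in> sym_W N d 1" by simp
  then have "Xi \<in> F_F N d" unfolding F_F_def by blast
  moreover have "Noise \<notin># X_pow d k" for k by (simp add: X_pow_def set_mset_sum)
  then have "Xi \<notin> range (X_pow d)" by (metis Xi_def imageE union_single_eq_member add_mset_add_single empty_neutral(1))
  ultimately show ?thesis by (simp add: proper_def)
qed

declare sym_W.simps [simp del] sym_U.simps [simp del]

lemma sum_singleton_mset: "(\<Sum>i<length xs. {#f (xs ! i)#}) = image_mset f (mset xs)"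
  by (induction xs rule: rev_induct) (simp_all add: nth_append)

text \<open>Finitely many factors occur at one common stage of the recursion, so their product
  occurs at a later one; a factor \<open>Integ\<close> rules out a monomial.\<close>

lemma product_proper:
  assumes S: "set_mset S \<subseteq> proper N d" and size: "1 \<le> size S" "size S \<le> N"
  shows "image_mset Integ S \<in> proper N d"
proof -
  have N: "N \<ge> 1" using size by simp
  have "\<forall>\<sigma>\<in>set_mset S. \<exists>m. \<sigma> \<in> sym_W N d m"
    using S by (auto simp: proper_def F_F_eq[OF N])
  then obtain f where f: "\<And>\<sigma>. \<sigma> \<in># S \<Longrightarrow> \<sigma> \<in> sym_W N d (f \<sigma>)" by metis
  define m where "m = Max (f ` set_mset S)"
  have m: "\<sigma> \<in> sym_W N d (Suc m)" if "\<sigma> \<in># S" for \<sigma>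
    using f[OF that] sym_W_mono[of "f \<sigma>" "Suc m" N d] that by (force simp: m_def intro: le_SucI)
  obtain xs where xs: "mset xs = S" using ex_mset by blast
  have len: "length xs = size S" using xs by auto
  have "I_op (xs ! i) \<in> sym_U N d (Suc m)" if "i < length xs" for i
  proof -
    have "xs ! i \<in># S" using that xs by auto
    then have "xs ! i \<in> sym_W N d (Suc m)" "xs ! i \<notin> range (X_pow d)"
      using m S by (blast, force simp: proper_def)
    then show ?thesis unfolding sym_U.simps(2) by blast
  qed
  then have "(\<Sum>i<size S. I_op (xs ! i))
      \<in> {(\<Sum>i<size S. \<tau> i) |\<tau>. \<forall>i<size S. \<tau> i \<in> sym_U N d (Suc m)}"
    using len by (intro CollectI exI[of _ "\<lambda>i. I_op (xs ! i)"]) simp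
  then have "(\<Sum>i<size S. I_op (xs ! i)) \<in> sym_W N d (Suc (Suc m))"
    using size unfolding sym_W.simps(2)[of N d "Suc m"] by (intro UnI2 UN_I[of "size S"]) auto
  also have "(\<Sum>i<size S. I_op (xs ! i)) = image_mset Integ S"
    using sum_singleton_mset[of Integ xs] len xs by (simp add: I_op_def)
  finally have "image_mset Integ S \<in> F_F N d" by (auto simp: F_F_eq[OF N])
  moreover have "image_mset Integ S \<notin> range (X_pow d)"
  proof
    assume "image_mset Integ S \<in> range (X_pow d)"
    then obtain k where "image_mset Integ S = X_pow d k" by auto
    moreover obtain \<sigma> where "\<sigma> \<in># S" using size(1) by fastforce
    ultimately show False using Integ_notin_X_pow by (metis imageI set_image_mset)
  qed
  ultimately show ?thesis by (simp add: proper_def)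
qed

text \<open>An inversion rule for the recursion: each factor of a product is a monomial or a planted
  symbol; the monomials are collected in \<open>A\<close>, the planted symbols in
  \<open>S\<close>.\<close>

lemma sym_W_cases:
  assumes "\<tau> \<in> sym_W N d (Suc m)"
  obtains "\<tau> = Xi"
  | A S where "\<tau> = A + image_mset Integ S" "set_mset A \<subseteq> X ` {..d}" "size S \<le> N"
      "set_mset S \<subseteq> sym_W N d m - range (X_pow d)"
proof -
  \<comment> \<open>The bound \<open>n\<close> is a parameter so that an induction can run over the
    factors of a product.\<close>
  let ?P = "\<lambda>m n \<tau>. \<exists>A S. \<tau> = A + image_mset Integ S \<and> set_mset A \<subseteq> X ` {..d} \<and>
    size S \<le> n \<and> set_mset S \<subseteq> sym_W N d m - range (X_pow d)"
  have U: "?P m 1 \<sigma>" if "\<sigma> \<in> sym_U N d m" for \<sigma> m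
  proof (cases m)
    case 0
    with that show ?thesis by (simp add: sym_U.simps)
  next
    case (Suc m')
    with that consider k where "\<sigma> = X_pow d k"
      | \<upsilon> where "\<sigma> = I_op \<upsilon>" "\<upsilon> \<in> sym_W N d m" "\<upsilon> \<notin> range (X_pow d)"
      by (auto simp: sym_U.simps)
    then show ?thesis
    proof cases
      case 1
      then show ?thesis by (intro exI[of _ "X_pow d k"] exI[of _ "{#}"]) (auto simp: X_pow_def set_mset_sum)
    next
      case 2
      then show ?thesis by (intro exI[of _ "{#}"] exI[of _ "{#\<upsilon>#}"]) (simp add: I_op_def)
    qed
  qed
  have prod: "?P m n (\<Sum>i<n. \<tau> i)" if "\<forall>i<n. \<tau> i \<in> sym_U N d m" for n m \<tau>
    using that
  proof (induction n)
    case 0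
    then show ?case by (intro exI[of _ "{#}"]) auto
  next
    case (Suc n)
    then obtain A S where "(\<Sum>i<n. \<tau> i) = A + image_mset Integ S" "set_mset A \<subseteq> X ` {..d}"
      "size S \<le> n" "set_mset S \<subseteq> sym_W N d m - range (X_pow d)" by (metis less_SucI)
    moreover obtain A' S' where "\<tau> n = A' + image_mset Integ S'" "set_mset A' \<subseteq> X ` {..d}"
      "size S' \<le> 1" "set_mset S' \<subseteq> sym_W N d m - range (X_pow d)"
      using U[of "\<tau> n" m] Suc.prems by blast
    ultimately show ?case by (intro exI[of _ "A + A'"] exI[of _ "S + S'"]) auto
  qed
  \<comment> \<open>The alternative of membership at the earlier stage is removed afterwards, by
    induction on \<open>m\<close>.\<close>
  have product: "\<tau> \<in> sym_W N d m \<or> \<tau> = Xi \<or> ?P m N \<tau>" if "\<tau> \<in> sym_W N d (Suc m)" for m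
  proof -
    from that consider "\<tau> \<in> sym_W N d m \<or> \<tau> = Xi"
      | n f where "n \<le> N" "\<tau> = (\<Sum>i<n. f i)" "\<forall>i<n. f i \<in> sym_U N d m"
      unfolding sym_W.simps(2)[of N d m] by fastforce
    then show ?thesis
    proof cases
      case 2
      from prod[OF 2(3)] 2(1) have "?P m N (\<Sum>i<n. f i)" by (meson order_trans)
      with 2(2) show ?thesis by simp
    qed blast
  qed
  have "\<tau> = Xi \<or> ?P m N \<tau>"
    using assms
  proof (induction m)
    case 0
    from 0 show ?case using product[of 0] by (auto simp: sym_W.simps(1))
  next
    case (Suc m)
    have "?P (Suc m) N \<tau>" if P: "?P m N \<tau>"
    proof -
      from P obtain A S where "\<tau> = A + image_mset Integ S" "set_mset A \<subseteq> X ` {..d}" "size S \<le> N"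
        "set_mset S \<subseteq> sym_W N d m - range (X_pow d)" by blast
      moreover have "sym_W N d m \<subseteq> sym_W N d (Suc m)" by (rule sym_W_mono) simp
      ultimately show ?thesis by (intro exI[of _ A] exI[of _ S]) auto
    qed
    with product[OF Suc.prems] Suc.IH show ?case by argo
  qed
  then show thesis using that by blast
qed

section \<open>Regular trees as symbols, and completion to regular trees\<close>

primrec tree_symbol :: "rtree \<Rightarrow> symbol" where
  "tree_symbol (Node ts) = (if ts = {#} then Xi else image_mset Integ (image_mset tree_symbol ts))"

text \<open>Injectivity is required only between an element of \<open>A\<close> and an arbitrary
  argument, which is the form in which the induction hypothesis on trees provides it.\<close>

lemma image_mset_inj:
  assumes "\<And>a b. a \<in># A \<Longrightarrow> f a = f b \<Longrightarrow> a = b" "image_mset f A = image_mset f B"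
  shows "A = B"
  using assms
proof (induction A arbitrary: B)
  case empty
  then show ?case by simp
next
  case (add a A)
  from add.prems(2) have "image_mset f B = add_mset (f a) (image_mset f A)" by simp
  then obtain B' b where B: "B = add_mset b B'" "f b = f a" "image_mset f B' = image_mset f A"
    by (elim msed_map_invR[elim_format]) blast
  have "a = b" by (rule add.prems(1)) (simp_all only: B(2) union_single_eq_member)
  moreover have "A = B'"
    using B(3) add.prems(1) by (intro add.IH) (auto intro: add.prems(1))
  ultimately show ?case using B(1) by simp
qed

text \<open>The factor \<open>Noise\<close> distinguishes a leaf from an inner vertex. At an inner
  vertex \<open>Integ\<close> is cancelled first; then the induction hypothesis identifies the
  children.\<close>

lemma inj_tree_symbol: "inj tree_symbol"
proof (rule injI)
  show "s = t" if "tree_symbol s = tree_symbol t" for s t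
    using that
  proof (induction s arbitrary: t)
    case (Node ss)
    obtain ts where t: "t = Node ts" by (cases t)
    have *: "Xi \<noteq> image_mset Integ M" for M
    proof
      assume "Xi = image_mset Integ M"
      then have "Noise \<in># image_mset Integ M" by (simp flip: \<open>Xi = image_mset Integ M\<close> add: Xi_def)
      then show False by auto
    qed
    show ?case
    proof (cases "ss = {#}")
      case True
      then show ?thesis using Node.prems t * by (auto split: if_splits)
    next
      case False
      then have "ts \<noteq> {#}" using Node.prems *[of "image_mset tree_symbol ss"] t
        by (auto split: if_splits)
      with False Node.prems t have eq: "image_mset Integ (image_mset tree_symbol ss) = image_mset Integ (image_mset tree_symbol ts)"
        by simp
      have "image_mset tree_symbol ss = image_mset tree_symbol ts"
        by (rule image_mset_inj[OF _ eq]) simp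
      then have "ss = ts" by (rule image_mset_inj[rotated]) (rule Node.IH)
      then show ?thesis using t by simp
    qed
  qed
qed

lemma tree_symbol_proper:
  assumes "N \<ge> 1" "regular N t"
  shows "tree_symbol t \<in> proper N d"
  using assms(2)
proof (induction t)
  case (Node ts)
  show ?case
  proof (cases "ts = {#}")
    case True
    then show ?thesis by (simp add: Xi_proper)
  next
    case False
    with Node product_proper[of "image_mset tree_symbol ts" N d] assms(1) show ?thesis by auto
  qed
qed

text \<open>
  One step removes a factor \<open>X\<^sub>i\<close> or adds a factor \<open>\<I>(\<Xi>)\<close> at some vertex. Every symbol that is not a
  monomial \<open>X\<^sup>k\<close> reaches a regular tree this way. The relation also contains pairs outside
  \<open>\<F>\<^sub>F\<close>; they are harmless, since it is only used to bound numbers of preimages from above.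
\<close>

inductive fill :: "nat \<Rightarrow> symbol \<Rightarrow> symbol \<Rightarrow> bool" for d where
  fill_X: "i \<le> d \<Longrightarrow> fill d (add_mset (X i) \<tau>) \<tau>"
| fill_leaf: "fill d \<tau> (add_mset (Integ Xi) \<tau>)"
| fill_Integ: "fill d \<sigma> \<sigma>' \<Longrightarrow> fill d (add_mset (Integ \<sigma>) \<tau>) (add_mset (Integ \<sigma>') \<tau>)"

lemma fill_add: "fill d \<sigma> \<tau> \<Longrightarrow> fill d (\<sigma> + \<rho>) (\<tau> + \<rho>)"
  by (induction rule: fill.induct) (auto intro: fill.intros)

lemma rtrancl_fill_add: "(fill d)\<^sup>*\<^sup>* \<sigma> \<tau> \<Longrightarrow> (fill d)\<^sup>*\<^sup>* (\<sigma> + \<rho>) (\<tau> + \<rho>)"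
  by (induction rule: rtranclp_induct) (auto intro: fill_add rtranclp.rtrancl_into_rtrancl)

lemma rtrancl_fill_Integ:
  "(fill d)\<^sup>*\<^sup>* \<sigma> \<sigma>' \<Longrightarrow> (fill d)\<^sup>*\<^sup>* (add_mset (Integ \<sigma>) \<tau>) (add_mset (Integ \<sigma>') \<tau>)"
  by (induction rule: rtranclp_induct) (auto intro: fill_Integ rtranclp.rtrancl_into_rtrancl)

lemma rtrancl_fill_X:
  "set_mset A \<subseteq> X ` {..d} \<Longrightarrow> (fill d)\<^sup>*\<^sup>* (A + \<tau>) \<tau>"
  by (induction A) (auto intro: fill_X converse_rtranclp_into_rtranclp)

lemma rtrancl_fill_leaves:
  "(fill d)\<^sup>*\<^sup>* \<tau> (\<tau> + replicate_mset j (Integ Xi))"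
proof (induction j)
  case (Suc j)
  then show ?case using fill_leaf[of d "\<tau> + replicate_mset j (Integ Xi)"]
    by (simp add: rtranclp.rtrancl_into_rtrancl)
qed simp

text \<open>At the root the factors \<open>X i\<close> are removed, the planted factors are
  completed by induction, and missing children are filled in as leaves.\<close>

lemma fill_to_tree:
  assumes "N \<ge> 1" "\<tau> \<in> proper N d"
  shows "\<exists>t. regular N t \<and> (fill d)\<^sup>*\<^sup>* \<tau> (tree_symbol t)"
proof -
  have "\<exists>t. regular N t \<and> (fill d)\<^sup>*\<^sup>* \<tau> (tree_symbol t)"
    if "\<tau> \<in> sym_W N d m" "\<tau> \<notin> range (X_pow d)" for m
    using that
  proof (induction m arbitrary: \<tau>)
    case 0
    then show ?case by (simp add: sym_W.simps)
  next
    case (Suc m)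
    from Suc.prems(1) show ?case
    proof (cases rule: sym_W_cases)
      case 1
      then show ?thesis by (intro exI[of _ "Node {#}"]) simp
    next
      case (2 A S)
      have S: "\<exists>ts. size ts = size R \<and> (\<forall>t\<in>#ts. regular N t) \<and>
          (fill d)\<^sup>*\<^sup>* (image_mset Integ R) (image_mset Integ (image_mset tree_symbol ts))"
        if "set_mset R \<subseteq> set_mset S" for R
        using that
      proof (induction R)
        case empty
        then show ?case by simp
      next
        case (add \<sigma> R)
        then obtain ts where ts: "size ts = size R" "\<forall>t\<in>#ts. regular N t"
          "(fill d)\<^sup>*\<^sup>* (image_mset Integ R) (image_mset Integ (image_mset tree_symbol ts))" by auto
        obtain t where t: "regular N t" "(fill d)\<^sup>*\<^sup>* \<sigma> (tree_symbol t)"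
          using Suc.IH[of \<sigma>] add.prems 2(4) by auto
        have "(fill d)\<^sup>*\<^sup>* (add_mset (Integ \<sigma>) (image_mset Integ R))
            (add_mset (Integ (tree_symbol t)) (image_mset Integ R))"
          by (rule rtrancl_fill_Integ[OF t(2)])
        also have "(fill d)\<^sup>*\<^sup>* \<dots>
            (add_mset (Integ (tree_symbol t)) (image_mset Integ (image_mset tree_symbol ts)))"
          using rtrancl_fill_add[OF ts(3), of "{#Integ (tree_symbol t)#}"] by simp
        finally show ?case using ts t by (intro exI[of _ "add_mset t ts"]) auto
      qed
      obtain ts where ts: "size ts = size S" "\<forall>t\<in>#ts. regular N t"
          "(fill d)\<^sup>*\<^sup>* (image_mset Integ S) (image_mset Integ (image_mset tree_symbol ts))"
        using S[of S] by auto
      define ts' where "ts' = ts + replicate_mset (N - size S) (Node {#})"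
      have size: "size ts' = N" and reg: "regular N (Node ts')"
        using ts 2(3) by (auto simp: ts'_def)
      have "(fill d)\<^sup>*\<^sup>* \<tau> (image_mset Integ S)"
        unfolding 2(1) by (rule rtrancl_fill_X[OF 2(2)])
      also note ts(3)
      also have "(fill d)\<^sup>*\<^sup>* (image_mset Integ (image_mset tree_symbol ts))
          (image_mset Integ (image_mset tree_symbol ts'))"
        using rtrancl_fill_leaves[of d "image_mset Integ (image_mset tree_symbol ts)" "N - size S"]
        by (simp add: ts'_def)
      also have "\<dots> = tree_symbol (Node ts')" using size assms(1) by auto
      finally show ?thesis using reg by blast
    qed
  qed
  then show ?thesis using assms by (auto simp: proper_def F_F_eq)
qed

section \<open>Counting the symbols that fill up to a given one\<close>

primrec factor_vertices :: "factor \<Rightarrow> nat" where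
  "factor_vertices (X i) = 0"
| "factor_vertices Noise = 0"
| "factor_vertices (Integ \<tau>) = Suc (sum_mset (image_mset factor_vertices \<tau>))"

text \<open>Each \<open>Integ\<close> is an edge and counts the child below it; \<open>Suc\<close>
  adds the root.\<close>

definition symbol_vertices :: "symbol \<Rightarrow> nat" where
  "symbol_vertices \<tau> = Suc (sum_mset (image_mset factor_vertices \<tau>))"

lemma symbol_vertices_tree: "symbol_vertices (tree_symbol t) = vertices t"
proof (induction t)
  case (Node ts)
  have "sum_mset (image_mset (\<lambda>t. factor_vertices (Integ (tree_symbol t))) us)
      = sum_mset (image_mset vertices us)" if "set_mset us \<subseteq> set_mset ts" for us
    using that Node.IH by (induction us) (auto simp: symbol_vertices_def)
  then show ?case
    by (auto simp: symbol_vertices_def Xi_def image_mset.compositionality comp_def)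
qed

text \<open>Removing \<open>X i\<close> leaves the count unchanged and a new leaf adds one. Thus the
  vertex number at the end of a chain of steps bounds all those along it.\<close>

lemma fill_vertices: "fill d \<sigma> \<tau> \<Longrightarrow> symbol_vertices \<sigma> \<le> symbol_vertices \<tau>"
  by (induction rule: fill.induct) (auto simp: symbol_vertices_def)

lemma sum_set_mset_le: "sum f (set_mset M) \<le> sum_mset (image_mset f M)" for f :: "'a \<Rightarrow> nat"
  by (induction M) (auto simp: sum.insert_if trans_le_add2)

text \<open>A preimage of \<open>\<tau>\<close> has one more factor \<open>X i\<close>
  (\<open>d + 1\<close> choices), one leaf less (one choice), or differs inside one planted factor.
  This amounts to \<open>d + 2\<close> choices for each vertex.\<close>

lemma fill_preimage_step:
  assumes "\<And>\<tau>'. Integ \<tau>' \<in># \<tau> \<Longrightarrow>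
    finite {\<sigma>. fill d \<sigma> \<tau>'} \<and> card {\<sigma>. fill d \<sigma> \<tau>'} \<le> (d + 2) * symbol_vertices \<tau>'"
  shows "finite {\<sigma>. fill d \<sigma> \<tau>} \<and> card {\<sigma>. fill d \<sigma> \<tau>} \<le> (d + 2) * symbol_vertices \<tau>"
proof -
  \<comment> \<open>The preimages that differ inside the factor \<open>f\<close>; there are none
    unless \<open>f\<close> is planted.\<close>
  define B where "B f = (\<lambda>\<sigma>. add_mset (Integ \<sigma>) (\<tau> - {#f#})) ` {\<sigma>. \<exists>\<tau>'. f = Integ \<tau>' \<and> fill d \<sigma> \<tau>'}" for f
  let ?A = "(\<lambda>i. add_mset (X i) \<tau>) ` {..d}"
  have B: "finite (B f) \<and> card (B f) \<le> (d + 2) * factor_vertices f" if "f \<in># \<tau>" for f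
  proof (cases f)
    case (Integ \<tau>')
    then have "B f = (\<lambda>\<sigma>. add_mset (Integ \<sigma>) (\<tau> - {#f#})) ` {\<sigma>. fill d \<sigma> \<tau>'}" by (simp add: B_def)
    moreover have "factor_vertices f = symbol_vertices \<tau>'" using Integ by (simp add: symbol_vertices_def)
    ultimately show ?thesis using assms[of \<tau>'] that Integ
      by (metis (no_types, lifting) card_image_le finite_imageI order_trans)
  qed (auto simp: B_def)
  \<comment> \<open>If \<open>\<tau>\<close> has no factor \<open>Integ Xi\<close>, the difference
    is \<open>\<tau>\<close> itself, which does no harm in a superset.\<close>
  have sub: "{\<sigma>. fill d \<sigma> \<tau>} \<subseteq> ?A \<union> ({\<tau> - {#Integ Xi#}} \<union> (\<Union>f\<in>set_mset \<tau>. B f))"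
  proof (rule subsetI, drule CollectD)
    fix \<sigma> assume "fill d \<sigma> \<tau>"
    then show "\<sigma> \<in> ?A \<union> ({\<tau> - {#Integ Xi#}} \<union> (\<Union>f\<in>set_mset \<tau>. B f))"
    proof cases
      case (fill_Integ \<upsilon> \<upsilon>' \<tau>'')
      then have "\<sigma> \<in> B (Integ \<upsilon>')" unfolding B_def by auto
      moreover have "Integ \<upsilon>' \<in># \<tau>" using fill_Integ by simp
      ultimately show ?thesis by blast
    qed auto
  qed
  have fin: "finite (?A \<union> ({\<tau> - {#Integ Xi#}} \<union> (\<Union>f\<in>set_mset \<tau>. B f)))" using B by auto
  have "card (?A \<union> ({\<tau> - {#Integ Xi#}} \<union> (\<Union>f\<in>set_mset \<tau>. B f)))
      \<le> card ?A + (card {\<tau> - {#Integ Xi#}} + card (\<Union>f\<in>set_mset \<tau>. B f))"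
    by (meson add_left_mono card_Un_le order_trans)
  also have "\<dots> \<le> (d + 1) + (1 + (\<Sum>f\<in>set_mset \<tau>. card (B f)))"
    using card_image_le[of "{..d}" "\<lambda>i. add_mset (X i) \<tau>"] card_UN_le[of "set_mset \<tau>" B]
    by (intro add_mono) auto
  also have "(\<Sum>f\<in>set_mset \<tau>. card (B f)) \<le> (\<Sum>f\<in>set_mset \<tau>. (d + 2) * factor_vertices f)"
    using B by (intro sum_mono) auto
  also have "\<dots> = (d + 2) * (\<Sum>f\<in>set_mset \<tau>. factor_vertices f)" by (rule sum_distrib_left[symmetric])
  also have "\<dots> \<le> (d + 2) * sum_mset (image_mset factor_vertices \<tau>)"
    by (intro mult_le_mono2 sum_set_mset_le)
  finally have "card (?A \<union> ({\<tau> - {#Integ Xi#}} \<union> (\<Union>f\<in>set_mset \<tau>. B f))) \<le> (d + 2) * symbol_vertices \<tau>"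
    by (simp add: symbol_vertices_def algebra_simps)
  with finite_subset[OF sub fin] card_mono[OF fin sub] show ?thesis by linarith
qed

text \<open>Symbols are only multisets over the datatype \<open>factor\<close>, so the induction
  runs over factors, with \<open>\<tau>\<close> wrapped in \<open>Integ\<close>.\<close>

lemma fill_preimage:
  "finite {\<sigma>. fill d \<sigma> \<tau>} \<and> card {\<sigma>. fill d \<sigma> \<tau>} \<le> (d + 2) * symbol_vertices \<tau>"
proof -
  have "\<forall>\<tau>. f = Integ \<tau> \<longrightarrow>
    finite {\<sigma>. fill d \<sigma> \<tau>} \<and> card {\<sigma>. fill d \<sigma> \<tau>} \<le> (d + 2) * symbol_vertices \<tau>" for f
  proof (induction f)
    case (Integ \<tau>)
    have "finite {\<sigma>. fill d \<sigma> \<tau>} \<and> card {\<sigma>. fill d \<sigma> \<tau>} \<le> (d + 2) * symbol_vertices \<tau>"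
      by (rule fill_preimage_step) (use Integ in simp)
    then show ?case by simp
  qed simp_all
  from this[of "Integ \<tau>"] show ?thesis by simp
qed

text \<open>All intermediate symbols have at most as many vertices as \<open>\<tau>\<close>, so the
  same bound serves for each of the \<open>q\<close> steps.\<close>

lemma fill_relpow_preimage:
  "finite {\<sigma>. (fill d ^^ q) \<sigma> \<tau>} \<and> card {\<sigma>. (fill d ^^ q) \<sigma> \<tau>} \<le> ((d + 2) * symbol_vertices \<tau>) ^ q"
proof (induction q arbitrary: \<tau>)
  case 0
  have "{\<sigma>. (fill d ^^ 0) \<sigma> \<tau>} = {\<tau>}" by auto
  then show ?case by simp
next
  case (Suc q)
  let ?P = "{\<sigma>. fill d \<sigma> \<tau>}"
  have eq: "{\<sigma>. (fill d ^^ Suc q) \<sigma> \<tau>} = (\<Union>\<upsilon>\<in>?P. {\<sigma>. (fill d ^^ q) \<sigma> \<upsilon>})"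
    by (auto simp: relcompp.simps)
  have "card (\<Union>\<upsilon>\<in>?P. {\<sigma>. (fill d ^^ q) \<sigma> \<upsilon>}) \<le> (\<Sum>\<upsilon>\<in>?P. card {\<sigma>. (fill d ^^ q) \<sigma> \<upsilon>})"
    using fill_preimage by (intro card_UN_le) blast
  also have "\<dots> \<le> (\<Sum>\<upsilon>\<in>?P. ((d + 2) * symbol_vertices \<tau>) ^ q)"
  proof (rule sum_mono)
    fix \<upsilon> assume "\<upsilon> \<in> ?P"
    then have "((d + 2) * symbol_vertices \<upsilon>) ^ q \<le> ((d + 2) * symbol_vertices \<tau>) ^ q"
      using fill_vertices by (intro power_mono mult_le_mono2) auto
    then show "card {\<sigma>. (fill d ^^ q) \<sigma> \<upsilon>} \<le> ((d + 2) * symbol_vertices \<tau>) ^ q"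
      using Suc.IH[of \<upsilon>] by linarith
  qed
  also have "\<dots> = card ?P * ((d + 2) * symbol_vertices \<tau>) ^ q" by simp
  also have "\<dots> \<le> ((d + 2) * symbol_vertices \<tau>) ^ Suc q"
    using fill_preimage[of d \<tau>] by (simp add: mult_right_mono)
  finally show ?case unfolding eq using fill_preimage Suc.IH by blast
qed

section \<open>Homogeneities near the critical value\<close>

text \<open>The homogeneity added by one inner vertex of a regular tree.\<close>

definition gap :: "nat \<Rightarrow> nat \<Rightarrow> real \<Rightarrow> real \<Rightarrow> real" where
  "gap N d \<rho> \<kappa> = real N * (alpha0 d \<rho> \<kappa> + \<rho>) - alpha0 d \<rho> \<kappa>"

text \<open>The largest \<open>m\<close> for which a regular tree with \<open>m\<close> inner vertices has homogeneity at most \<open>h\<close>.\<close>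

definition max_inner :: "nat \<Rightarrow> nat \<Rightarrow> real \<Rightarrow> real \<Rightarrow> real \<Rightarrow> nat" where
  "max_inner N d \<rho> \<kappa> h = nat \<lfloor>(h - alpha0 d \<rho> \<kappa>) / gap N d \<rho> \<kappa>\<rfloor>"

definition num_neg_le :: "nat \<Rightarrow> nat \<Rightarrow> real \<Rightarrow> real \<Rightarrow> real \<Rightarrow> nat" where
  "num_neg_le N d \<rho> \<kappa> h = card {\<tau> \<in> F_neg N d \<rho> \<kappa>. hom d \<rho> \<kappa> \<tau> \<le> h}"

lemma num_neg_le_0: "num_neg_le N d \<rho> \<kappa> 0 = card (F_neg N d \<rho> \<kappa>)"
proof -
  have "{\<tau> \<in> F_neg N d \<rho> \<kappa>. hom d \<rho> \<kappa> \<tau> \<le> 0} = F_neg N d \<rho> \<kappa>" by (auto simp: F_neg_def)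
  then show ?thesis by (simp add: num_neg_le_def)
qed

text \<open>Here \<open>b\<close> bounds from below the homogeneity lost in one \<open>fill\<close>
  step: removing \<open>X i\<close> costs \<open>\<rho>\<close> or 1, adding a leaf costs
  \<open>- (alpha0 d \<rho> \<kappa> + \<rho>)\<close>. The assumption \<open>gap_pos\<close> is
  local subcriticality.\<close>

locale near_critical =
  fixes N d :: nat and \<rho> \<kappa> b :: real
  assumes N: "N \<ge> 2"
    and b: "0 < b" "b \<le> 1" "b \<le> \<rho>" "alpha0 d \<rho> \<kappa> + \<rho> \<le> - b"
    and gap_pos: "gap N d \<rho> \<kappa> > 0"
begin

abbreviation (input) "\<alpha> \<equiv> alpha0 d \<rho> \<kappa>"
abbreviation (input) "\<delta> \<equiv> gap N d \<rho> \<kappa>"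
abbreviation (input) "H \<equiv> hom d \<rho> \<kappa>"

lemma alpha_neg: "\<alpha> < 0"
  using b by linarith

lemma hom_fill: "fill d \<sigma> \<tau> \<Longrightarrow> H \<tau> + b \<le> H \<sigma>"
proof (induction rule: fill.induct)
  case (fill_X i \<tau>)
  then show ?case using b by (auto simp: hom_def)
next
  case (fill_leaf \<tau>)
  then show ?case using b by (simp add: hom_def Xi_def)
next
  case (fill_Integ \<sigma> \<sigma>' \<tau>)
  then show ?case by (simp add: hom_def)
qed

lemma hom_fill_relpow: "(fill d ^^ q) \<sigma> \<tau> \<Longrightarrow> H \<tau> + real q * b \<le> H \<sigma>"
proof (induction q arbitrary: \<tau>)
  case (Suc q)
  then obtain \<upsilon> where "(fill d ^^ q) \<sigma> \<upsilon>" "fill d \<upsilon> \<tau>" by auto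
  with Suc.IH hom_fill show ?case by (fastforce simp: algebra_simps)
qed simp

text \<open>The factor \<open>N\<close> lets vertices be counted instead of inner vertices:
  \<open>vertices t - 1\<close> is \<open>N\<close> times the number of the latter, and it is
  additive over the children.\<close>

lemma hom_tree_aux:
  "regular N t \<Longrightarrow> real N * (H (tree_symbol t) - \<alpha>) = (real (vertices t) - 1) * \<delta>"
proof (induction t)
  case (Node ts)
  have children: "real N * H (image_mset Integ (image_mset tree_symbol us))
      = real (size us) * (real N * (\<alpha> + \<rho>)) + (real (sum_mset (image_mset vertices us)) - real (size us)) * \<delta>"
    if "set_mset us \<subseteq> set_mset ts" for us
    using that
  proof (induction us)
    case empty
    then show ?case by (simp add: hom_def)
  next
    case (add u us)
    then have "real N * (H (tree_symbol u) - \<alpha>) = (real (vertices u) - 1) * \<delta>"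
      using Node by auto
    then have "real N * (H (tree_symbol u) + \<rho>) = real N * (\<alpha> + \<rho>) + (real (vertices u) - 1) * \<delta>"
      by (simp add: algebra_simps)
    moreover have "H (image_mset Integ (image_mset tree_symbol (add_mset u us)))
        = (H (tree_symbol u) + \<rho>) + H (image_mset Integ (image_mset tree_symbol us))"
      by (simp add: hom_def)
    ultimately show ?case using add.IH add.prems
      by (simp add: distrib_left) (simp add: algebra_simps)
  qed
  show ?case
  proof (cases "ts = {#}")
    case True
    then show ?thesis by (simp add: hom_Xi)
  next
    case False
    with Node.prems have "size ts = N" by auto
    with children[of ts] False show ?thesis
      by (simp add: gap_def) (simp add: algebra_simps)
  qed
qed

lemma hom_tree:
  assumes "t \<in> reg_trees N (N * m + 1)"
  shows "H (tree_symbol t) = \<alpha> + real m * \<delta>"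
  using hom_tree_aux[of t] assms N by (auto simp: reg_trees_def)

lemma hom_X_pow_nonneg: "H (X_pow d k) \<ge> 0"
  using b by (auto simp: hom_X_pow intro!: add_nonneg_nonneg sum_nonneg)

text \<open>The homogeneity pays separately for the \<open>m\<close> inner vertices of the
  completion and for the \<open>q\<close> steps leading to it, so an upper bound on it bounds both
  numbers.\<close>

lemma proper_completion:
  assumes "\<tau> \<in> proper N d"
  obtains q m t where "t \<in> reg_trees N (N * m + 1)" "(fill d ^^ q) \<tau> (tree_symbol t)"
    "\<alpha> + real m * \<delta> + real q * b \<le> H \<tau>"
proof -
  obtain t where t: "regular N t" "(fill d)\<^sup>*\<^sup>* \<tau> (tree_symbol t)"
    using fill_to_tree[of N \<tau> d] assms N by auto
  obtain m where m: "vertices t = N * m + 1" using vertices_regular[OF t(1)] by blast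
  obtain q where q: "(fill d ^^ q) \<tau> (tree_symbol t)" using rtranclp_imp_relpowp[OF t(2)] by blast
  have mem: "t \<in> reg_trees N (N * m + 1)" using t m by (simp add: reg_trees_def)
  show thesis using that[OF mem q] hom_fill_relpow[OF q] hom_tree[OF mem] by simp
qed

lemma hom_proper_ge: "\<tau> \<in> proper N d \<Longrightarrow> H \<tau> \<ge> \<alpha>"
proof (erule proper_completion)
  fix q m :: nat
  assume "\<alpha> + real m * \<delta> + real q * b \<le> H \<tau>"
  moreover have "real m * \<delta> \<ge> 0" "real q * b \<ge> 0" using gap_pos b by auto
  ultimately show ?thesis by linarith
qed

lemma neg_proper: "\<tau> \<in> F_neg N d \<rho> \<kappa> \<longleftrightarrow> \<tau> \<in> proper N d \<and> H \<tau> < 0"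
  using hom_X_pow_nonneg by (auto simp: F_neg_def proper_def not_less[symmetric])

abbreviation (input) "level h \<equiv> max_inner N d \<rho> \<kappa> h"

lemma le_level:
  assumes "\<alpha> + real m * \<delta> \<le> h"
  shows "m \<le> level h"
proof -
  have "real m \<le> (h - \<alpha>) / \<delta>" using assms gap_pos by (simp add: pos_le_divide_eq)
  then show ?thesis unfolding max_inner_def by (simp add: le_nat_floor)
qed

text \<open>Negativity forces \<open>q \<le> Q\<close>, and homogeneity at most \<open>h\<close>
  forces \<open>m \<le> level h\<close>. The four factors count the values of \<open>q\<close>, the
  values of \<open>m\<close>, the preimages of one tree, and the trees.\<close>

lemma neg_le_finite_card:
  assumes Q: "- \<alpha> \<le> real Q * b" and h: "h \<le> 0"
  shows "finite {\<tau> \<in> F_neg N d \<rho> \<kappa>. H \<tau> \<le> h} \<and>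
    num_neg_le N d \<rho> \<kappa> h \<le> (Q + 1) * (level h + 1) *
      ((d + 2) * (N * level h + 1)) ^ Q * inner_count N (level h)"
proof -
  let ?M = "level h"
  define P where "P q m = (\<Union>t\<in>reg_trees N (N * m + 1). {\<sigma>. (fill d ^^ q) \<sigma> (tree_symbol t)})" for q m
  let ?B = "((d + 2) * (N * ?M + 1)) ^ Q * inner_count N ?M"
  have sub: "{\<tau> \<in> F_neg N d \<rho> \<kappa>. H \<tau> \<le> h} \<subseteq> (\<Union>q\<in>{..Q}. \<Union>m\<in>{..?M}. P q m)"
  proof
    fix \<tau> assume "\<tau> \<in> {\<tau> \<in> F_neg N d \<rho> \<kappa>. H \<tau> \<le> h}"
    then have \<tau>: "\<tau> \<in> proper N d" "H \<tau> \<le> h" "H \<tau> < 0" by (auto simp: neg_proper)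
    obtain q m t where t: "t \<in> reg_trees N (N * m + 1)" "(fill d ^^ q) \<tau> (tree_symbol t)"
      "\<alpha> + real m * \<delta> + real q * b \<le> H \<tau>" using proper_completion[OF \<tau>(1)] .
    have nonneg: "real m * \<delta> \<ge> 0" "real q * b \<ge> 0" using gap_pos b by auto
    have "m \<le> ?M" by (rule le_level) (use t(3) \<tau>(2) nonneg in linarith)
    moreover have "real q * b \<le> real Q * b" using t(3) \<tau>(3) nonneg Q by linarith
    then have "q \<le> Q" using b(1) by simp
    ultimately show "\<tau> \<in> (\<Union>q\<in>{..Q}. \<Union>m\<in>{..?M}. P q m)" using t unfolding P_def by blast
  qed
  have P: "finite (P q m) \<and> card (P q m) \<le> ?B" if "q \<le> Q" "m \<le> ?M" for q m
  proof -
    have "card (P q m) \<le> (\<Sum>t\<in>reg_trees N (N * m + 1). card {\<sigma>. (fill d ^^ q) \<sigma> (tree_symbol t)})"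
      unfolding P_def by (rule card_UN_le) (rule finite_reg_trees)
    also have "\<dots> \<le> (\<Sum>t\<in>reg_trees N (N * m + 1). ((d + 2) * (N * ?M + 1)) ^ Q)"
    proof (rule sum_mono)
      fix t assume t: "t \<in> reg_trees N (N * m + 1)"
      have "vertices t = N * m + 1" using t by (simp add: reg_trees_def)
      then have "card {\<sigma>. (fill d ^^ q) \<sigma> (tree_symbol t)} \<le> ((d + 2) * (N * m + 1)) ^ q"
        using fill_relpow_preimage[of q d "tree_symbol t"]
        unfolding symbol_vertices_tree by (simp only:)
      also have "\<dots> \<le> ((d + 2) * (N * ?M + 1)) ^ q"
        using that by (intro power_mono mult_le_mono add_mono) auto
      also have "\<dots> \<le> ((d + 2) * (N * ?M + 1)) ^ Q"
        using that by (intro power_increasing) auto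
      finally show "card {\<sigma>. (fill d ^^ q) \<sigma> (tree_symbol t)} \<le> ((d + 2) * (N * ?M + 1)) ^ Q" .
    qed
    also have "\<dots> = ((d + 2) * (N * ?M + 1)) ^ Q * inner_count N m"
      by (simp add: inner_count_def num_regular_eq)
    also have "\<dots> \<le> ?B"
      using monoD[OF inner_count_mono[of N] that(2)] N by (intro mult_le_mono2) simp
    finally have "card (P q m) \<le> ?B" .
    moreover have "finite (P q m)" unfolding P_def using finite_reg_trees fill_relpow_preimage by blast
    ultimately show ?thesis by blast
  qed
  have fin: "finite (\<Union>q\<in>{..Q}. \<Union>m\<in>{..?M}. P q m)" using P by auto
  have "card (\<Union>q\<in>{..Q}. \<Union>m\<in>{..?M}. P q m) \<le> (\<Sum>q\<in>{..Q}. card (\<Union>m\<in>{..?M}. P q m))"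
    by (rule card_UN_le) simp
  also have "\<dots> \<le> (\<Sum>q\<in>{..Q}. \<Sum>m\<in>{..?M}. card (P q m))"
    by (intro sum_mono card_UN_le) simp
  also have "\<dots> \<le> (\<Sum>q\<in>{..Q}. \<Sum>m\<in>{..?M}. ?B)"
    using P by (intro sum_mono) auto
  also have "\<dots> = (Q + 1) * (?M + 1) * ?B"
    by (simp only: sum_constant card_atMost of_nat_id mult.assoc Suc_eq_plus1)
  finally have "card (\<Union>q\<in>{..Q}. \<Union>m\<in>{..?M}. P q m) \<le> (Q + 1) * (?M + 1) * ?B" .
  from finite_subset[OF sub fin] order_trans[OF card_mono[OF fin sub] this] show ?thesis
    unfolding num_neg_le_def mult.assoc by (rule conjI)
qed

lemma finite_neg: "finite (F_neg N d \<rho> \<kappa>)"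
proof -
  obtain Q :: nat where "- \<alpha> < real Q * b" using reals_Archimedean3[OF b(1)] by blast
  then have "- \<alpha> \<le> real Q * b" by simp
  moreover have "{\<tau> \<in> F_neg N d \<rho> \<kappa>. H \<tau> \<le> 0} = F_neg N d \<rho> \<kappa>" by (auto simp: F_neg_def)
  ultimately show ?thesis using neg_le_finite_card[of Q 0] by simp
qed

text \<open>Regular trees with this number of inner vertices embed into the set counted. The
  \<open>- 1\<close> keeps their homogeneity strictly negative even for \<open>h = 0\<close>; at
  level 0 truncated subtraction leaves the tree of \<open>Xi\<close>.\<close>

lemma num_neg_le_lower:
  assumes h: "\<alpha> \<le> h" "h \<le> 0"
  shows "inner_count N (level h - 1) \<le> num_neg_le N d \<rho> \<kappa> h"
proof -
  let ?m = "level h - 1"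
  have bounds: "\<alpha> + real ?m * \<delta> \<le> h \<and> \<alpha> + real ?m * \<delta> < 0"
  proof (cases "level h = 0")
    case True
    then show ?thesis using h alpha_neg by simp
  next
    case False
    then have "real (level h) \<le> (h - \<alpha>) / \<delta>"
      using h gap_pos by (simp add: max_inner_def)
    then have "real (level h) * \<delta> \<le> h - \<alpha>" using gap_pos by (simp add: pos_le_divide_eq)
    moreover have "real ?m * \<delta> = real (level h) * \<delta> - \<delta>" using False
      by (simp add: of_nat_diff algebra_simps)
    ultimately show ?thesis using gap_pos h by linarith
  qed
  have "tree_symbol ` reg_trees N (N * ?m + 1) \<subseteq> {\<tau> \<in> F_neg N d \<rho> \<kappa>. H \<tau> \<le> h}"
  proof (rule image_subsetI)
    fix t assume t: "t \<in> reg_trees N (N * ?m + 1)"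
    then have "tree_symbol t \<in> proper N d"
      using tree_symbol_proper[of N t d] N by (simp add: reg_trees_def)
    with hom_tree[OF t] bounds show "tree_symbol t \<in> {\<tau> \<in> F_neg N d \<rho> \<kappa>. H \<tau> \<le> h}"
      by (simp add: neg_proper)
  qed
  moreover have "finite {\<tau> \<in> F_neg N d \<rho> \<kappa>. H \<tau> \<le> h}" using finite_neg by simp
  moreover have "inj_on tree_symbol (reg_trees N (N * ?m + 1))"
    using inj_tree_symbol inj_on_subset by blast
  ultimately show ?thesis
    unfolding num_neg_le_def inner_count_def num_regular_eq by (intro card_inj_on_le)
qed

text \<open>
  Both \<open>graft1 \<circ> graft1\<close> and \<open>graft2\<close> raise the homogeneity by twice the gap. Their images are
  disjoint up to one symbol, so each step of that size doubles the number of symbols.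
\<close>

definition graft1 :: "symbol \<Rightarrow> symbol" where
  "graft1 \<tau> = {#Integ \<tau>#} + replicate_mset (N - 1) (Integ Xi)"

definition graft2 :: "symbol \<Rightarrow> symbol" where
  "graft2 \<tau> = {#Integ \<tau>, Integ (graft1 Xi)#} + replicate_mset (N - 2) (Integ Xi)"

lemma hom_replicate_leaf: "H (replicate_mset n (Integ Xi)) = real n * (\<alpha> + \<rho>)"
  by (simp add: hom_def Xi_def)

lemma hom_graft1: "H (graft1 \<tau>) = H \<tau> + \<delta>"
proof -
  have "H (graft1 \<tau>) = H \<tau> + \<rho> + real (N - 1) * (\<alpha> + \<rho>)"
    unfolding graft1_def hom_mult hom_replicate_leaf by (simp add: hom_def)
  then show ?thesis using N by (simp add: gap_def of_nat_diff algebra_simps)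
qed

lemma hom_graft2: "H (graft2 \<tau>) = H \<tau> + 2 * \<delta>"
proof -
  have "H (graft2 \<tau>) = H \<tau> + \<rho> + (H (graft1 Xi) + \<rho>) + real (N - 2) * (\<alpha> + \<rho>)"
    unfolding graft2_def hom_mult hom_replicate_leaf by (simp add: hom_def)
  then show ?thesis using N by (simp add: hom_graft1 hom_Xi gap_def of_nat_diff algebra_simps)
qed

lemma graft1_proper: "\<tau> \<in> proper N d \<Longrightarrow> graft1 \<tau> \<in> proper N d"
  using product_proper[of "add_mset \<tau> (replicate_mset (N - 1) Xi)" N d] N Xi_proper[of N d]
  by (auto simp: graft1_def)

lemma graft2_proper: "\<tau> \<in> proper N d \<Longrightarrow> graft2 \<tau> \<in> proper N d"
  using product_proper[of "add_mset \<tau> (add_mset (graft1 Xi) (replicate_mset (N - 2) Xi))" N d]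
    N Xi_proper[of N d] graft1_proper[OF Xi_proper]
  by (auto simp: graft2_def)

lemma Noise_notin_graft: "Noise \<notin># graft1 \<tau>" "Noise \<notin># graft2 \<tau>"
  by (auto simp: graft1_def graft2_def)

lemma graft_neq_Xi: "graft1 \<tau> \<noteq> Xi" "graft2 \<tau> \<noteq> Xi"
  using Noise_notin_graft[of \<tau>] by (metis Xi_def union_single_eq_member add_mset_add_single empty_neutral(1))+

lemma inj_graft: "inj graft1" "inj graft2"
  by (auto intro!: injI simp: graft1_def graft2_def)

text \<open>After the common leaves are cancelled, \<open>Integ Xi\<close> must be one of the two
  remaining factors on the right, and it is not \<open>Integ (graft1 Xi)\<close>.\<close>

lemma graft_disjoint:
  assumes "graft1 (graft1 \<sigma>) = graft2 \<tau>"
  shows "\<tau> = Xi"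
proof -
  have "replicate_mset (N - 1) (Integ Xi) = add_mset (Integ Xi) (replicate_mset (N - 2) (Integ Xi))"
    using N by (metis Suc_diff_Suc Suc_1 Suc_le_lessD diff_Suc_1 replicate_mset_Suc numeral_2_eq_2)
  with assms have "{#Integ (graft1 \<sigma>), Integ Xi#} + replicate_mset (N - 2) (Integ Xi)
      = {#Integ \<tau>, Integ (graft1 Xi)#} + replicate_mset (N - 2) (Integ Xi)"
    unfolding graft2_def graft1_def[of "graft1 \<sigma>"] by simp
  then have "{#Integ (graft1 \<sigma>), Integ Xi#} = {#Integ \<tau>, Integ (graft1 Xi)#}"
    unfolding add_right_cancel .
  then have "Integ Xi \<in># {#Integ \<tau>, Integ (graft1 Xi)#}"
    by (metis add_mset_commute union_single_eq_member add_mset_add_single)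
  then show ?thesis using graft_neq_Xi(1)[of Xi] by auto
qed

section \<open>Moments of the homogeneity\<close>

text \<open>Let S be the sum of squares. The two grafted copies of \<open>L\<close>, together with
  \<open>Xi\<close>, bound S from below by twice the sum over \<open>L\<close> of the squares
  shifted by \<open>2 * \<delta>\<close>. Comparing shifted and unshifted squares gives S \<le> 12
  \<delta>^2 n + 3/4 S, with n the number of negative symbols.\<close>

lemma second_moment:
  "(\<Sum>\<tau>\<in>F_neg N d \<rho> \<kappa>. (H \<tau>)\<^sup>2) \<le> 48 * \<delta>\<^sup>2 * real (card (F_neg N d \<rho> \<kappa>))"
proof -
  let ?F = "F_neg N d \<rho> \<kappa>"
  define L where "L = {\<tau> \<in> ?F. H \<tau> < - 2 * \<delta>}"
  have fin: "finite ?F" "finite L" using finite_neg by (auto simp: L_def)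
  let ?s = "\<lambda>\<tau>. (H \<tau> + 2 * \<delta>)\<^sup>2"
  have g1: "inj_on (graft1 \<circ> graft1) L" and g2: "inj_on graft2 (L - {Xi})"
    using inj_graft by (meson inj_compose inj_on_subset subset_UNIV)+
  have doubled: "2 * (\<Sum>\<tau>\<in>L. ?s \<tau>) \<le> (\<Sum>\<tau>\<in>?F. (H \<tau>)\<^sup>2)"
  proof (cases "Xi \<in> L")
    case False
    \<comment> \<open>\<open>Xi\<close> has the least homogeneity, so \<open>L\<close> is empty
      unless it contains \<open>Xi\<close>.\<close>
    have "\<tau> \<notin> L" for \<tau>
    proof
      assume "\<tau> \<in> L"
      then have "\<alpha> < - 2 * \<delta>" using hom_proper_ge[of \<tau>] by (auto simp: L_def neg_proper)
      then have "Xi \<in> L" using Xi_proper[of N d] alpha_neg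
        by (simp add: L_def neg_proper hom_Xi)
      with False show False ..
    qed
    then have "L = {}" by blast
    then show ?thesis by (simp add: sum_nonneg)
  next
    case True
    \<comment> \<open>\<open>Xi\<close> is left out of the second copy, where the two grafts may
      collide. The term lost is made up for by \<open>Xi\<close> itself, which is no graft.\<close>
    let ?A = "(graft1 \<circ> graft1) ` L" and ?B = "graft2 ` (L - {Xi})"
    have AB: "?A \<inter> ?B = {}" using graft_disjoint by fastforce
    have X: "Xi \<notin> ?A \<union> ?B" using graft_neq_Xi by (metis Un_iff comp_apply imageE)
    have sub: "insert Xi (?A \<union> ?B) \<subseteq> ?F"
    proof -
      have "graft1 (graft1 \<tau>) \<in> ?F" "graft2 \<tau> \<in> ?F" if "\<tau> \<in> L" for \<tau>
        using that by (simp_all add: L_def neg_proper hom_graft1 hom_graft2 graft1_proper graft2_proper)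
      then show ?thesis using True by (auto simp: L_def)
    qed
    have "(H Xi + 2 * \<delta>)\<^sup>2 \<le> (H Xi)\<^sup>2"
      using True gap_pos by (intro abs_le_square_iff[THEN iffD1]) (auto simp: L_def)
    then have "2 * (\<Sum>\<tau>\<in>L. ?s \<tau>) \<le> (H Xi)\<^sup>2 + ((\<Sum>\<tau>\<in>L. ?s \<tau>) + (\<Sum>\<tau>\<in>L - {Xi}. ?s \<tau>))"
      using sum.remove[OF fin(2) True, of ?s] by simp
    also have "\<dots> = (H Xi)\<^sup>2 + ((\<Sum>\<tau>\<in>?A. (H \<tau>)\<^sup>2) + (\<Sum>\<tau>\<in>?B. (H \<tau>)\<^sup>2))"
      unfolding sum.reindex[OF g1] sum.reindex[OF g2]
      by (simp add: hom_graft1 hom_graft2 add.assoc)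
    also have "\<dots> = (\<Sum>\<tau>\<in>insert Xi (?A \<union> ?B). (H \<tau>)\<^sup>2)"
      using X AB fin by (subst sum.insert) (auto simp: sum.union_disjoint)
    also have "\<dots> \<le> (\<Sum>\<tau>\<in>?F. (H \<tau>)\<^sup>2)"
      by (rule sum_mono2[OF fin(1) sub]) simp
    finally show ?thesis .
  qed
  \<comment> \<open>The constant 12 is chosen to match the one in \<open>far\<close>.\<close>
  have near: "(H \<tau>)\<^sup>2 \<le> 12 * \<delta>\<^sup>2" if "\<tau> \<in> ?F - L" for \<tau>
  proof -
    have "\<bar>H \<tau>\<bar> \<le> \<bar>2 * \<delta>\<bar>" using that by (auto simp: L_def F_neg_def)
    then have "(H \<tau>)\<^sup>2 \<le> (2 * \<delta>)\<^sup>2" by (rule abs_le_square_iff[THEN iffD1])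
    also have "\<dots> \<le> 12 * \<delta>\<^sup>2" by (simp add: power_mult_distrib)
    finally show ?thesis .
  qed
  \<comment> \<open>Completing the square. The factor \<open>3 / 2\<close> is halved by
    \<open>doubled\<close>, and the resulting \<open>3 / 4\<close> is below 1, so the sum can be
    absorbed on the left.\<close>
  have far: "(H \<tau>)\<^sup>2 \<le> 3 / 2 * ?s \<tau> + 12 * \<delta>\<^sup>2" for \<tau>
  proof -
    have "3 / 2 * ?s \<tau> + 12 * \<delta>\<^sup>2 - (H \<tau>)\<^sup>2 = (H \<tau> + 6 * \<delta>)\<^sup>2 / 2"
      by (simp add: power2_eq_square algebra_simps)
    then show ?thesis by (smt (verit) zero_le_power2 divide_nonneg_pos)
  qed
  have "(\<Sum>\<tau>\<in>?F. (H \<tau>)\<^sup>2) = (\<Sum>\<tau>\<in>?F - L. (H \<tau>)\<^sup>2) + (\<Sum>\<tau>\<in>L. (H \<tau>)\<^sup>2)"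
    by (rule sum.subset_diff) (use fin in \<open>auto simp: L_def\<close>)
  also have "\<dots> \<le> (\<Sum>\<tau>\<in>?F - L. 12 * \<delta>\<^sup>2) + (\<Sum>\<tau>\<in>L. 3 / 2 * ?s \<tau> + 12 * \<delta>\<^sup>2)"
    using near far by (intro add_mono sum_mono) auto
  also have "\<dots> = ((\<Sum>\<tau>\<in>?F - L. 12 * \<delta>\<^sup>2) + (\<Sum>\<tau>\<in>L. 12 * \<delta>\<^sup>2)) + 3 / 2 * (\<Sum>\<tau>\<in>L. ?s \<tau>)"
    by (simp only: sum.distrib sum_distrib_left add_ac)
  also have "(\<Sum>\<tau>\<in>?F - L. 12 * \<delta>\<^sup>2) + (\<Sum>\<tau>\<in>L. 12 * \<delta>\<^sup>2) = (\<Sum>\<tau>\<in>?F. 12 * \<delta>\<^sup>2)"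
    by (rule sum.subset_diff[symmetric]) (use fin in \<open>auto simp: L_def\<close>)
  finally have "(\<Sum>\<tau>\<in>?F. (H \<tau>)\<^sup>2) \<le> 12 * \<delta>\<^sup>2 * real (card ?F) + 3 / 4 * (\<Sum>\<tau>\<in>?F. (H \<tau>)\<^sup>2)"
    using doubled by (simp add: mult.commute)
  then show ?thesis by simp
qed

lemma neg_nonempty: "F_neg N d \<rho> \<kappa> \<noteq> {}"
  using Xi_proper[of N d] alpha_neg neg_proper[of Xi] by (auto simp: hom_Xi)

text \<open>The second moment bounds the variance and, as the variance is nonnegative, also the
  squared expectation; the 7 comes from \<open>48 \<le> 7 * 7\<close>.\<close>

lemma moments:
  defines "p \<equiv> unif_neg N d \<rho> \<kappa>"
  shows "\<bar>measure_pmf.expectation p H\<bar> \<le> 7 * \<delta>"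
    and "\<bar>measure_pmf.variance p H\<bar> \<le> 48 * \<delta>\<^sup>2"
    and "measure_pmf.prob p {\<tau>. H \<tau> \<le> h} = real (num_neg_le N d \<rho> \<kappa> h) / real (num_neg_le N d \<rho> \<kappa> 0)"
proof -
  note F = neg_nonempty finite_neg
  have fin: "finite (set_pmf p)" using F by (simp add: p_def unif_neg_def)
  have int: "integrable (measure_pmf p) f" for f :: "symbol \<Rightarrow> real"
    by (rule integrable_measure_pmf_finite[OF fin])
  have "measure_pmf.expectation p (\<lambda>\<tau>. (H \<tau>)\<^sup>2) \<le> 48 * \<delta>\<^sup>2"
    using second_moment F unfolding p_def unif_neg_def
    by (simp add: integral_pmf_of_set pos_divide_le_eq card_gt_0_iff)
  moreover have var: "measure_pmf.variance p H
      = measure_pmf.expectation p (\<lambda>\<tau>. (H \<tau>)\<^sup>2) - (measure_pmf.expectation p H)\<^sup>2"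
    by (rule measure_pmf.variance_eq[OF int int])
  moreover have pos: "measure_pmf.variance p H \<ge> 0" by (rule measure_pmf.variance_positive)
  ultimately have E: "(measure_pmf.expectation p H)\<^sup>2 \<le> 48 * \<delta>\<^sup>2"
    and V: "measure_pmf.variance p H \<le> 48 * \<delta>\<^sup>2" by (smt (verit) zero_le_power2)+
  show "\<bar>measure_pmf.variance p H\<bar> \<le> 48 * \<delta>\<^sup>2" using V pos by simp
  have "(measure_pmf.expectation p H)\<^sup>2 \<le> (7 * \<delta>)\<^sup>2"
  proof -
    have "(7 * \<delta>)\<^sup>2 = 49 * \<delta>\<^sup>2" by (simp add: power_mult_distrib)
    with E zero_le_power2[of \<delta>] show ?thesis by linarith
  qed
  then have "\<bar>measure_pmf.expectation p H\<bar> \<le> \<bar>7 * \<delta>\<bar>" by (rule abs_le_square_iff[THEN iffD2])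
  then show "\<bar>measure_pmf.expectation p H\<bar> \<le> 7 * \<delta>" using gap_pos by simp
  have "F_neg N d \<rho> \<kappa> \<inter> {\<tau>. H \<tau> \<le> h} = {\<tau> \<in> F_neg N d \<rho> \<kappa>. H \<tau> \<le> h}" by blast
  then show "measure_pmf.prob p {\<tau>. H \<tau> \<le> h} = real (num_neg_le N d \<rho> \<kappa> h) / real (num_neg_le N d \<rho> \<kappa> 0)"
    using F unfolding num_neg_le_0 by (simp add: p_def unif_neg_def measure_pmf_of_set num_neg_le_def)
qed

end

section \<open>Logarithmic asymptotics of the number of symbols\<close>

text \<open>The tangent bound \<open>ln x \<le> \<eta> * x - 1 - ln \<eta>\<close> has arbitrarily
  small slope \<open>\<eta>\<close>; as the polynomial has degree \<open>Q + 1\<close>, the slope is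
  \<open>\<epsilon> / (Q + 1)\<close>.\<close>

lemma ln_polynomial_le:
  fixes N d Q :: nat and \<epsilon> :: real
  assumes "\<epsilon> > 0"
  shows "\<exists>C. \<forall>M. ln (real ((Q + 1) * (M + 1) * ((d + 2) * (N * M + 1)) ^ Q)) \<le> \<epsilon> * real M + C"
proof -
  define K where "K = (Q + 1) * ((d + 2) * (N + 1)) ^ Q"
  define \<eta> where "\<eta> = \<epsilon> / real (Q + 1)"
  have \<eta>: "\<eta> > 0" "real (Q + 1) * \<eta> = \<epsilon>" using assms by (simp_all add: \<eta>_def)
  have "ln (real ((Q + 1) * (M + 1) * ((d + 2) * (N * M + 1)) ^ Q))
      \<le> \<epsilon> * real M + (ln (real K) + \<epsilon> - real (Q + 1) - real (Q + 1) * ln \<eta>)" for M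
  proof -
    have "(d + 2) * (N * M + 1) \<le> (d + 2) * ((N + 1) * (M + 1))"
      by (intro mult_le_mono2) simp
    also have "\<dots> = (d + 2) * (N + 1) * (M + 1)" by (rule mult.assoc[symmetric])
    finally have "((d + 2) * (N * M + 1)) ^ Q \<le> ((d + 2) * (N + 1) * (M + 1)) ^ Q"
      by (rule power_mono) simp
    then have "(Q + 1) * (M + 1) * ((d + 2) * (N * M + 1)) ^ Q
        \<le> (Q + 1) * (M + 1) * ((d + 2) * (N + 1) * (M + 1)) ^ Q"
      by (rule mult_le_mono2)
    also have "\<dots> = K * (M + 1) ^ (Q + 1)"
      unfolding K_def power_mult_distrib power_add power_one_right by (simp only: mult_ac)
    finally have "real ((Q + 1) * (M + 1) * ((d + 2) * (N * M + 1)) ^ Q) \<le> real (K * (M + 1) ^ (Q + 1))"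
      by (simp only: of_nat_le_iff)
    moreover have "(Q + 1) * (M + 1) * ((d + 2) * (N * M + 1)) ^ Q > 0" by simp
    ultimately have "ln (real ((Q + 1) * (M + 1) * ((d + 2) * (N * M + 1)) ^ Q))
        \<le> ln (real (K * (M + 1) ^ (Q + 1)))"
      by (intro ln_mono) (simp_all only: of_nat_0_less_iff)
    also have "\<dots> = ln (real K) + real (Q + 1) * ln (real (M + 1))"
    proof -
      have "K > 0" unfolding K_def by (intro mult_pos_pos zero_less_power) simp_all
      then have "ln (real K * real (M + 1) ^ (Q + 1)) = ln (real K) + ln (real (M + 1) ^ (Q + 1))"
        by (intro ln_mult_pos zero_less_power) simp_all
      also have "ln (real (M + 1) ^ (Q + 1)) = real (Q + 1) * ln (real (M + 1))"
        by (rule ln_realpow)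
      finally show ?thesis unfolding of_nat_mult of_nat_power .
    qed
    also have "\<dots> \<le> ln (real K) + real (Q + 1) * (\<eta> * real (M + 1) - 1 - ln \<eta>)"
      using ln_le_minus_one[of "\<eta> * real (M + 1)"] \<eta>(1)
      by (intro add_left_mono mult_left_mono) (simp_all add: ln_mult)
    also have "\<dots> = ln (real K) + (real (Q + 1) * \<eta>) * real (M + 1) - real (Q + 1) - real (Q + 1) * ln \<eta>"
      by (simp only: algebra_simps mult_1_left)
    also have "\<dots> = \<epsilon> * real M + (ln (real K) + \<epsilon> - real (Q + 1) - real (Q + 1) * ln \<eta>)"
      unfolding \<eta>(2) by (simp add: algebra_simps)
    finally show ?thesis .
  qed
  then show ?thesis by blast
qed

text \<open>The constant \<open>C\<close> is uniform in \<open>\<rho>\<close>,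
  \<open>\<kappa>\<close> and \<open>h\<close>, which enter the bounds on the count only through
  \<open>max_inner\<close>. Hence the error term \<open>C\<close> vanishes when multiplied by
  \<open>\<rho> - rho_c N d\<close>.\<close>

lemma ln_num_neg_le:
  assumes N: "N \<ge> 2" and \<epsilon>: "\<epsilon> > 0"
  shows "\<exists>C. \<forall>\<rho> \<kappa> h. near_critical N d \<rho> \<kappa> b \<longrightarrow> - alpha0 d \<rho> \<kappa> \<le> real Q * b \<longrightarrow>
    alpha0 d \<rho> \<kappa> \<le> h \<longrightarrow> h \<le> 0 \<longrightarrow>
    \<bar>ln (real (num_neg_le N d \<rho> \<kappa> h)) - growth_rate N * real (max_inner N d \<rho> \<kappa> h)\<bar>
      \<le> \<epsilon> * real (max_inner N d \<rho> \<kappa> h) + C"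
proof -
  obtain C1 where C1: "\<And>m. \<bar>ln (real (inner_count N m)) - growth_rate N * real m\<bar> \<le> \<epsilon> / 2 * real m + C1"
    using ln_inner_count[OF N, of "\<epsilon> / 2"] \<epsilon> by auto
  obtain C2 where C2: "\<And>M. ln (real ((Q + 1) * (M + 1) * ((d + 2) * (N * M + 1)) ^ Q)) \<le> \<epsilon> / 2 * real M + C2"
    using ln_polynomial_le[of "\<epsilon> / 2" Q d N] \<epsilon> by auto
  have pos: "real (inner_count N m) > 0" for m using inner_count_pos[of N m] N by simp
  have "\<bar>ln (real (num_neg_le N d \<rho> \<kappa> h)) - growth_rate N * real (max_inner N d \<rho> \<kappa> h)\<bar>
      \<le> \<epsilon> * real (max_inner N d \<rho> \<kappa> h) + (\<bar>C1\<bar> + \<bar>C2\<bar> + \<bar>growth_rate N\<bar>)"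
    if "near_critical N d \<rho> \<kappa> b" and Q: "- alpha0 d \<rho> \<kappa> \<le> real Q * b"
      and h: "alpha0 d \<rho> \<kappa> \<le> h" "h \<le> 0" for \<rho> \<kappa> h
  proof -
    interpret near_critical N d \<rho> \<kappa> b by fact
    let ?M = "max_inner N d \<rho> \<kappa> h" and ?K = "num_neg_le N d \<rho> \<kappa> h"
    let ?p = "(Q + 1) * (?M + 1) * ((d + 2) * (N * ?M + 1)) ^ Q"
    have lower: "inner_count N (?M - 1) \<le> ?K" by (rule num_neg_le_lower[OF h])
    have K: "real ?K > 0" using lower pos[of "?M - 1"] by linarith
    have "?K \<le> ?p * inner_count N ?M"
      using neg_le_finite_card[OF Q h(2)] by blast
    then have "real ?K \<le> real (?p * inner_count N ?M)" by (simp only: of_nat_le_iff)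
    then have "ln (real ?K) \<le> ln (real (?p * inner_count N ?M))" using K by (rule ln_mono)
    also have "\<dots> = ln (real ?p) + ln (real (inner_count N ?M))"
      unfolding of_nat_mult[of ?p]
    proof (rule ln_mult_pos)
      show "real ?p > 0" unfolding of_nat_0_less_iff by (intro mult_pos_pos zero_less_power) simp_all
    qed (rule pos)
    finally have "ln (real ?K) \<le> ln (real ?p) + ln (real (inner_count N ?M))" .
    then have 1: "ln (real ?K) - growth_rate N * real ?M \<le> \<epsilon> * real ?M + C1 + C2"
      using C1[of ?M] C2[of ?M] by linarith
    have "ln (real (inner_count N (?M - 1))) \<le> ln (real ?K)"
      using lower pos[of "?M - 1"] by (intro ln_mono) simp_all
    then have "ln (real ?K) \<ge> growth_rate N * real (?M - 1) - \<epsilon> / 2 * real (?M - 1) - C1"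
      using C1[of "?M - 1"] by linarith
    moreover have "\<epsilon> / 2 * real (?M - 1) \<le> \<epsilon> * real ?M"
      using \<epsilon> by (intro mult_mono) auto
    \<comment> \<open>Passing from \<open>?M - 1\<close> to \<open>?M\<close> changes the main term
      by at most one growth rate; for \<open>?M = 0\<close> both agree.\<close>
    moreover have "growth_rate N * real (?M - 1) \<ge> growth_rate N * real ?M - \<bar>growth_rate N\<bar>"
      by (cases "?M = 0") (simp_all add: of_nat_diff algebra_simps)
    ultimately have 2: "ln (real ?K) - growth_rate N * real ?M \<ge> - (\<epsilon> * real ?M) - C1 - \<bar>growth_rate N\<bar>"
      by linarith
    show ?thesis using 1 2 by linarith
  qed
  then show ?thesis by blast
qed

text \<open>For \<open>\<kappa> = 0\<close> the gap closes exactly at \<open>rho_c N d\<close>; a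
  positive \<open>\<kappa>\<close> makes it smaller.\<close>

lemma gap_eq: "gap N d \<rho> \<kappa> = (real N + 1) / 2 * (\<rho> - rho_c N d) - (real N - 1) * \<kappa>"
proof -
  have "(real N + 1) * rho_c N d = real d * (real N - 1)" by (simp add: rho_c_def)
  moreover have "a / 2 * (x - y) = (a * x - a * y) / 2" for a x y :: real by (simp add: field_simps)
  ultimately have 1: "(real N + 1) / 2 * (\<rho> - rho_c N d) = ((real N + 1) * \<rho> - real d * (real N - 1)) / 2"
    by (simp only:)
  have \<alpha>: "2 * alpha0 d \<rho> \<kappa> = - (\<rho> + real d) - 2 * \<kappa>" by (simp add: alpha0_def)
  have "2 * gap N d \<rho> \<kappa> = real N * (2 * alpha0 d \<rho> \<kappa> + 2 * \<rho>) - 2 * alpha0 d \<rho> \<kappa>"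
    by (simp add: gap_def algebra_simps)
  also have "\<dots> = (real N + 1) * \<rho> - real d * (real N - 1) - 2 * ((real N - 1) * \<kappa>)"
    unfolding \<alpha> by (simp add: algebra_simps)
  finally have "2 * gap N d \<rho> \<kappa> = \<dots>" .
  moreover have "2 * g = u - 2 * v \<Longrightarrow> g = u / 2 - v" for g u v :: real by simp
  ultimately show ?thesis unfolding 1 by blast
qed

section \<open>The limit\<close>

text \<open>\<open>\<kappa>\<close> is a function of \<open>\<rho>\<close> because it has to stay
  below \<open>\<rho> - rho_c N d\<close> in the limit. The assumption \<open>subcritical\<close>
  says that \<open>gap\<close> is positive.\<close>

context
  fixes N d :: nat and \<kappa> :: "real \<Rightarrow> real"
  assumes N: "N \<ge> 2" and d: "d \<ge> 1"
    and \<kappa>: "\<forall>\<^sub>F \<rho> in at_right (rho_c N d). 0 < \<kappa> \<rho> \<and> \<kappa> \<rho> < \<rho> - rho_c N d"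
    and subcritical: "\<forall>\<^sub>F \<rho> in at_right (rho_c N d).
      real N * (alpha0 d \<rho> (\<kappa> \<rho>) + \<rho>) > alpha0 d \<rho> (\<kappa> \<rho>)"
begin

private abbreviation (input) "F \<equiv> at_right (rho_c N d)"
private abbreviation (input) "t \<rho> \<equiv> \<rho> - rho_c N d"

lemma t_pos: "\<forall>\<^sub>F \<rho> in F. t \<rho> > 0"
  using eventually_at_right_less[of "rho_c N d"] by simp

lemma t_tendsto: "(t \<longlongrightarrow> 0) F"
  by (intro tendsto_eq_intros) auto

lemma kappa_tendsto: "(\<kappa> \<longlongrightarrow> 0) F"
proof (rule tendsto_sandwich[OF _ _ tendsto_const t_tendsto])
  show "\<forall>\<^sub>F \<rho> in F. 0 \<le> \<kappa> \<rho>" using \<kappa> by eventually_elim simp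
  show "\<forall>\<^sub>F \<rho> in F. \<kappa> \<rho> \<le> t \<rho>" using \<kappa> by eventually_elim simp
qed

lemma alpha0_tendsto: "((\<lambda>\<rho>. alpha0 d \<rho> (\<kappa> \<rho>)) \<longlongrightarrow> - (real N * real d / (real N + 1))) F"
proof -
  have "((\<lambda>\<rho>. alpha0 d \<rho> (\<kappa> \<rho>)) \<longlongrightarrow> - (rho_c N d + real d) / 2 - 0) F"
    unfolding alpha0_def by (intro tendsto_intros kappa_tendsto) simp
  moreover have "- (rho_c N d + real d) / 2 - 0 = - (real N * real d / (real N + 1))"
    by (simp add: rho_c_def field_simps)
  ultimately show ?thesis by (simp only:)
qed

text \<open>The homogeneity of a planted leaf tends to \<open>- d / (N + 1)\<close>, so half of
  \<open>d / (N + 1)\<close> is still a valid cost per leaf; \<open>Q\<close> covers the limit of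
  \<open>- alpha0\<close> with margin 1.\<close>

lemma eventually_near_critical:
  "\<exists>b Q. \<forall>\<^sub>F \<rho> in F. near_critical N d \<rho> (\<kappa> \<rho>) b \<and> - alpha0 d \<rho> (\<kappa> \<rho>) \<le> real Q * b"
proof -
  define b where "b = min 1 (min (rho_c N d) (real d / (real N + 1) / 2))"
  have b: "0 < b" "b \<le> 1" "b \<le> rho_c N d" "b \<le> real d / (real N + 1) / 2"
    using N d by (auto simp: b_def rho_c_def)
  let ?A = "real N * real d / (real N + 1)"
  obtain Q :: nat where Q: "?A + 1 < real Q * b" using reals_Archimedean3[OF b(1)] by blast
  have "((\<lambda>\<rho>. alpha0 d \<rho> (\<kappa> \<rho>) + \<rho>) \<longlongrightarrow> - ?A + rho_c N d) F"
    by (intro tendsto_add alpha0_tendsto tendsto_ident_at)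
  moreover have "- ?A + rho_c N d < - b"
  proof -
    have "- ?A + rho_c N d = - (real d / (real N + 1))"
      by (simp add: rho_c_def right_diff_distrib diff_divide_distrib mult.commute)
    moreover have "x > 0 \<Longrightarrow> b \<le> x / 2 \<Longrightarrow> - x < - b" for x by linarith
    moreover have "real d / (real N + 1) > 0" using d by simp
    ultimately show ?thesis using b(4) by (simp only:)
  qed
  ultimately have "\<forall>\<^sub>F \<rho> in F. alpha0 d \<rho> (\<kappa> \<rho>) + \<rho> < - b" by (rule order_tendstoD(2))
  moreover have "\<forall>\<^sub>F \<rho> in F. alpha0 d \<rho> (\<kappa> \<rho>) > - ?A - 1"
    by (rule order_tendstoD(1)[OF alpha0_tendsto]) simp
  ultimately have "\<forall>\<^sub>F \<rho> in F. near_critical N d \<rho> (\<kappa> \<rho>) b \<and> - alpha0 d \<rho> (\<kappa> \<rho>) \<le> real Q * b"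
    using subcritical t_pos
  proof eventually_elim
    case (elim \<rho>)
    have "near_critical N d \<rho> (\<kappa> \<rho>) b"
      using elim b N by unfold_locales (auto simp: gap_def)
    then show ?case using elim Q by simp
  qed
  then show ?thesis by blast
qed

text \<open>With \<open>\<kappa>\<close> of smaller order than \<open>t\<close>, the gap is
  asymptotic to \<open>(N + 1) / 2 * t\<close>, which fixes the constant. The floor in
  \<open>max_inner\<close> costs at most 1, hence at most \<open>t\<close> after scaling.\<close>

lemma max_inner_scaled:
  assumes small: "\<kappa> \<in> o[F](t)" and h: "\<forall>\<^sub>F \<rho> in F. alpha0 d \<rho> (\<kappa> \<rho>) \<le> h"
  shows "((\<lambda>\<rho>. t \<rho> * real (max_inner N d \<rho> (\<kappa> \<rho>) h))
    \<longlongrightarrow> 2 / (real N + 1) * (h + real N * real d / (real N + 1))) F"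
proof -
  define y where "y \<rho> = (h - alpha0 d \<rho> (\<kappa> \<rho>)) / gap N d \<rho> (\<kappa> \<rho>)" for \<rho>
  have "((\<lambda>\<rho>. (real N + 1) / 2 - (real N - 1) * (\<kappa> \<rho> / t \<rho>)) \<longlongrightarrow> (real N + 1) / 2 - (real N - 1) * 0) F"
    by (intro tendsto_intros smalloD_tendsto small)
  then have "((\<lambda>\<rho>. inverse ((real N + 1) / 2 - (real N - 1) * (\<kappa> \<rho> / t \<rho>))) \<longlongrightarrow> inverse ((real N + 1) / 2)) F"
    by (intro tendsto_inverse) auto
  moreover have "\<forall>\<^sub>F \<rho> in F. inverse ((real N + 1) / 2 - (real N - 1) * (\<kappa> \<rho> / t \<rho>)) = t \<rho> / gap N d \<rho> (\<kappa> \<rho>)"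
    using t_pos
  proof eventually_elim
    case (elim \<rho>)
    have "a / 2 - c * (k / s) = (a / 2 * s - c * k) / s" if "s > 0" for a c k s :: real
      using that by (simp add: field_simps)
    from this[OF elim] have "(real N + 1) / 2 - (real N - 1) * (\<kappa> \<rho> / t \<rho>) = gap N d \<rho> (\<kappa> \<rho>) / t \<rho>"
      unfolding gap_eq .
    then show ?case by simp
  qed
  ultimately have "((\<lambda>\<rho>. t \<rho> / gap N d \<rho> (\<kappa> \<rho>)) \<longlongrightarrow> inverse ((real N + 1) / 2)) F"
    by (rule Lim_transform_eventually)
  then have "((\<lambda>\<rho>. t \<rho> / gap N d \<rho> (\<kappa> \<rho>) * (h - alpha0 d \<rho> (\<kappa> \<rho>)))
      \<longlongrightarrow> inverse ((real N + 1) / 2) * (h - - (real N * real d / (real N + 1)))) F"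
    by (intro tendsto_intros alpha0_tendsto)
  then have y: "((\<lambda>\<rho>. t \<rho> * y \<rho>) \<longlongrightarrow> 2 / (real N + 1) * (h + real N * real d / (real N + 1))) F"
    by (simp add: y_def)
  have diff: "((\<lambda>\<rho>. t \<rho> * y \<rho> - t \<rho>) \<longlongrightarrow> 2 / (real N + 1) * (h + real N * real d / (real N + 1))) F"
    using tendsto_diff[OF y t_tendsto] by simp
  have bounds: "\<forall>\<^sub>F \<rho> in F. y \<rho> - 1 \<le> real (max_inner N d \<rho> (\<kappa> \<rho>) h) \<and> real (max_inner N d \<rho> (\<kappa> \<rho>) h) \<le> y \<rho>"
    using h subcritical
  proof eventually_elim
    case (elim \<rho>)
    then have "y \<rho> \<ge> 0" by (simp add: y_def gap_def)
    then show ?case unfolding max_inner_def y_def[symmetric] by linarith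
  qed
  show ?thesis
  proof (rule tendsto_sandwich[OF _ _ diff y])
    show "\<forall>\<^sub>F \<rho> in F. t \<rho> * y \<rho> - t \<rho> \<le> t \<rho> * real (max_inner N d \<rho> (\<kappa> \<rho>) h)"
      using bounds t_pos
    proof eventually_elim
      case (elim \<rho>)
      then have "t \<rho> * (y \<rho> - 1) \<le> t \<rho> * real (max_inner N d \<rho> (\<kappa> \<rho>) h)" by (intro mult_left_mono) auto
      then show ?case by (simp add: right_diff_distrib)
    qed
    show "\<forall>\<^sub>F \<rho> in F. t \<rho> * real (max_inner N d \<rho> (\<kappa> \<rho>) h) \<le> t \<rho> * y \<rho>"
      using bounds t_pos by eventually_elim (intro mult_left_mono, auto)
  qed
qed

text \<open>The scaled error is at most \<open>\<epsilon> * (t * M) + t * C\<close>. As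
  \<open>t * M\<close> converges and \<open>t\<close> tends to 0, only the main term contributes to
  the limit.\<close>

lemma ln_num_neg_le_scaled:
  assumes small: "\<kappa> \<in> o[F](t)" and h: "\<forall>\<^sub>F \<rho> in F. alpha0 d \<rho> (\<kappa> \<rho>) \<le> h" "h \<le> 0"
  shows "((\<lambda>\<rho>. t \<rho> * ln (real (num_neg_le N d \<rho> (\<kappa> \<rho>) h)))
    \<longlongrightarrow> growth_rate N * (2 / (real N + 1) * (h + real N * real d / (real N + 1)))) F"
proof -
  let ?M = "\<lambda>\<rho>. real (max_inner N d \<rho> (\<kappa> \<rho>) h)"
  let ?K = "\<lambda>\<rho>. ln (real (num_neg_le N d \<rho> (\<kappa> \<rho>) h))"
  let ?\<mu> = "2 / (real N + 1) * (h + real N * real d / (real N + 1))"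
  note M = max_inner_scaled[OF small h(1)]
  obtain b Q where crit: "\<forall>\<^sub>F \<rho> in F. near_critical N d \<rho> (\<kappa> \<rho>) b \<and> - alpha0 d \<rho> (\<kappa> \<rho>) \<le> real Q * b"
    using eventually_near_critical by blast
  have "((\<lambda>\<rho>. t \<rho> * (?K \<rho> - growth_rate N * ?M \<rho>)) \<longlongrightarrow> 0) F"
  proof (rule tendstoI)
    fix e :: real assume e: "e > 0"
    define m where "m = \<bar>?\<mu>\<bar> + 1"
    have m: "m > 0" "?\<mu> < m" unfolding m_def by linarith+
    define \<epsilon> where "\<epsilon> = e / 2 / m"
    have \<epsilon>: "\<epsilon> > 0" "\<epsilon> * m = e / 2"
      using e m(1) by (simp_all add: \<epsilon>_def)
    obtain C where C: "\<And>\<rho> \<kappa> h. near_critical N d \<rho> \<kappa> b \<Longrightarrow> - alpha0 d \<rho> \<kappa> \<le> real Q * b \<Longrightarrow>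
      alpha0 d \<rho> \<kappa> \<le> h \<Longrightarrow> h \<le> 0 \<Longrightarrow>
      \<bar>ln (real (num_neg_le N d \<rho> \<kappa> h)) - growth_rate N * real (max_inner N d \<rho> \<kappa> h)\<bar>
        \<le> \<epsilon> * real (max_inner N d \<rho> \<kappa> h) + C"
      using ln_num_neg_le[OF N \<epsilon>(1), of d b Q] by blast
    have "\<forall>\<^sub>F \<rho> in F. t \<rho> * ?M \<rho> < m" by (rule order_tendstoD(2)[OF M m(2)])
    moreover have "((\<lambda>\<rho>. t \<rho> * C) \<longlongrightarrow> 0 * C) F" by (intro tendsto_intros t_tendsto)
    then have "\<forall>\<^sub>F \<rho> in F. t \<rho> * C < e / 2" by (rule order_tendstoD(2)) (use e in simp)
    ultimately show "\<forall>\<^sub>F \<rho> in F. dist (t \<rho> * (?K \<rho> - growth_rate N * ?M \<rho>)) 0 < e"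
      using crit h(1) t_pos
    proof eventually_elim
      case (elim \<rho>)
      have "\<bar>t \<rho> * (?K \<rho> - growth_rate N * ?M \<rho>)\<bar> = t \<rho> * \<bar>?K \<rho> - growth_rate N * ?M \<rho>\<bar>"
        using elim by (simp add: abs_mult)
      also have "\<dots> \<le> t \<rho> * (\<epsilon> * ?M \<rho> + C)"
        using elim C h(2) by (intro mult_left_mono) auto
      also have "\<dots> = \<epsilon> * (t \<rho> * ?M \<rho>) + t \<rho> * C" by (simp add: algebra_simps)
      also have "\<dots> < \<epsilon> * m + e / 2"
        using elim \<epsilon>(1) by (intro add_strict_mono mult_strict_left_mono) auto
      finally show ?case using \<epsilon>(2) by (simp add: dist_real_def)
    qed
  qed
  from tendsto_add[OF this tendsto_mult[OF tendsto_const M, of "growth_rate N"]]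
  show ?thesis by (simp add: algebra_simps)
qed

section \<open>Moments and large deviations at the critical value\<close>

text \<open>Positivity of \<open>\<kappa>\<close> gives \<open>gap \<le> (N + 1) / 2 * t\<close>,
  which turns bounds in units of the gap into bounds in units of \<open>t\<close>.\<close>

lemma expectation_variance_bigo:
  shows "(\<lambda>\<rho>. measure_pmf.expectation (unif_neg N d \<rho> (\<kappa> \<rho>)) (hom d \<rho> (\<kappa> \<rho>))) \<in> O[F](t)"
    and "(\<lambda>\<rho>. measure_pmf.variance (unif_neg N d \<rho> (\<kappa> \<rho>)) (hom d \<rho> (\<kappa> \<rho>))) \<in> O[F](\<lambda>\<rho>. (t \<rho>)\<^sup>2)"
proof -
  obtain b Q where "\<forall>\<^sub>F \<rho> in F. near_critical N d \<rho> (\<kappa> \<rho>) b \<and> - alpha0 d \<rho> (\<kappa> \<rho>) \<le> real Q * b"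
    using eventually_near_critical by blast
  then have crit: "\<forall>\<^sub>F \<rho> in F. near_critical N d \<rho> (\<kappa> \<rho>) b" by eventually_elim simp
  let ?c = "(real N + 1) / 2"
  have gap: "\<forall>\<^sub>F \<rho> in F. 0 < gap N d \<rho> (\<kappa> \<rho>) \<and> gap N d \<rho> (\<kappa> \<rho>) \<le> ?c * t \<rho>"
    using \<kappa> subcritical
  proof eventually_elim
    case (elim \<rho>)
    have "(real N - 1) * \<kappa> \<rho> \<ge> 0" using elim N by simp
    then have "gap N d \<rho> (\<kappa> \<rho>) \<le> ?c * t \<rho>" unfolding gap_eq by linarith
    then show ?case using elim by (simp add: gap_def)
  qed
  show "(\<lambda>\<rho>. measure_pmf.expectation (unif_neg N d \<rho> (\<kappa> \<rho>)) (hom d \<rho> (\<kappa> \<rho>))) \<in> O[F](t)"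
  proof (rule bigoI)
    show "\<forall>\<^sub>F \<rho> in F. norm (measure_pmf.expectation (unif_neg N d \<rho> (\<kappa> \<rho>)) (hom d \<rho> (\<kappa> \<rho>)))
        \<le> (7 * ?c) * norm (t \<rho>)"
      using crit gap t_pos
    proof eventually_elim
      case (elim \<rho>)
      have "7 * gap N d \<rho> (\<kappa> \<rho>) \<le> 7 * ?c * t \<rho>"
        unfolding mult.assoc[of 7] using elim(2) by (intro mult_left_mono) auto
      from order_trans[OF near_critical.moments(1)[OF elim(1)] this] elim(3) show ?case
        by (simp only: real_norm_def abs_of_pos)
    qed
  qed
  show "(\<lambda>\<rho>. measure_pmf.variance (unif_neg N d \<rho> (\<kappa> \<rho>)) (hom d \<rho> (\<kappa> \<rho>))) \<in> O[F](\<lambda>\<rho>. (t \<rho>)\<^sup>2)"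
  proof (rule bigoI)
    show "\<forall>\<^sub>F \<rho> in F. norm (measure_pmf.variance (unif_neg N d \<rho> (\<kappa> \<rho>)) (hom d \<rho> (\<kappa> \<rho>)))
        \<le> (48 * ?c\<^sup>2) * norm ((t \<rho>)\<^sup>2)"
      using crit gap t_pos
    proof eventually_elim
      case (elim \<rho>)
      have "(gap N d \<rho> (\<kappa> \<rho>))\<^sup>2 \<le> (?c * t \<rho>)\<^sup>2" using elim(2) by (intro power_mono) auto
      then have "48 * (gap N d \<rho> (\<kappa> \<rho>))\<^sup>2 \<le> 48 * ?c\<^sup>2 * (t \<rho>)\<^sup>2"
        unfolding mult.assoc[of 48] power_mult_distrib[symmetric] by (intro mult_left_mono) auto
      from order_trans[OF near_critical.moments(2)[OF elim(1)] this] show ?case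
        by (simp only: real_norm_def abs_power2)
    qed
  qed
qed

text \<open>The probability is the quotient of the counts at \<open>h\<close> and at 0. The two
  limits are subtracted, the contribution of \<open>alpha0\<close> cancels, and a multiple of
  \<open>- h\<close> remains.\<close>

lemma large_deviation:
  assumes small: "\<kappa> \<in> o[F](t)" and h: "\<forall>\<^sub>F \<rho> in F. h \<in> {alpha0 d \<rho> (\<kappa> \<rho>)..0}"
  shows "((\<lambda>\<rho>. - (t \<rho> * ln (measure_pmf.prob (unif_neg N d \<rho> (\<kappa> \<rho>)) {\<tau>. hom d \<rho> (\<kappa> \<rho>) \<tau> \<le> h})))
    \<longlongrightarrow> (real N + 1) / real N * beta N * (- h)) F"
proof -
  let ?K = "\<lambda>h \<rho>. ln (real (num_neg_le N d \<rho> (\<kappa> \<rho>) h))"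
  let ?A = "real N * real d / (real N + 1)"
  have h0: "h \<le> 0" and ev: "\<forall>\<^sub>F \<rho> in F. alpha0 d \<rho> (\<kappa> \<rho>) \<le> h"
    using eventually_happens'[OF trivial_limit_at_right_real h] h
    by (auto elim: eventually_mono)
  have ev0: "\<forall>\<^sub>F \<rho> in F. alpha0 d \<rho> (\<kappa> \<rho>) \<le> 0" using ev by eventually_elim (use h0 in simp)
  obtain b Q where "\<forall>\<^sub>F \<rho> in F. near_critical N d \<rho> (\<kappa> \<rho>) b \<and> - alpha0 d \<rho> (\<kappa> \<rho>) \<le> real Q * b"
    using eventually_near_critical by blast
  then have crit: "\<forall>\<^sub>F \<rho> in F. near_critical N d \<rho> (\<kappa> \<rho>) b" by eventually_elim simp
  have "((\<lambda>\<rho>. - (t \<rho> * ?K h \<rho> - t \<rho> * ?K 0 \<rho>)) \<longlongrightarrow>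
      - (growth_rate N * (2 / (real N + 1) * (h + ?A)) - growth_rate N * (2 / (real N + 1) * (0 + ?A)))) F"
    by (intro tendsto_intros ln_num_neg_le_scaled small ev h0 ev0 order_refl)
  moreover have "\<forall>\<^sub>F \<rho> in F. - (t \<rho> * ?K h \<rho> - t \<rho> * ?K 0 \<rho>)
      = - (t \<rho> * ln (measure_pmf.prob (unif_neg N d \<rho> (\<kappa> \<rho>)) {\<tau>. hom d \<rho> (\<kappa> \<rho>) \<tau> \<le> h}))"
    using crit ev ev0
  proof eventually_elim
    case (elim \<rho>)
    interpret near_critical N d \<rho> "\<kappa> \<rho>" b by (rule elim(1))
    have pos: "inner_count N m > 0" for m using inner_count_pos[of N m] N by simp
    have "num_neg_le N d \<rho> (\<kappa> \<rho>) h > 0" "num_neg_le N d \<rho> (\<kappa> \<rho>) 0 > 0"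
      using num_neg_le_lower[OF elim(2) h0] num_neg_le_lower[OF elim(3)] pos
      by (meson order_less_le_trans order_refl)+
    then show ?case unfolding moments(3) by (simp add: ln_div right_diff_distrib)
  qed
  ultimately have "((\<lambda>\<rho>. - (t \<rho> * ln (measure_pmf.prob (unif_neg N d \<rho> (\<kappa> \<rho>)) {\<tau>. hom d \<rho> (\<kappa> \<rho>) \<tau> \<le> h}))) \<longlongrightarrow>
      - (growth_rate N * (2 / (real N + 1) * (h + ?A)) - growth_rate N * (2 / (real N + 1) * (0 + ?A)))) F"
    by (rule Lim_transform_eventually)
  moreover have "- (growth_rate N * (2 / (real N + 1) * (h + ?A)) - growth_rate N * (2 / (real N + 1) * (0 + ?A)))
      = (real N + 1) / real N * beta N * (- h)"
  proof -
    have "- (growth_rate N * (2 / (real N + 1) * (h + ?A)) - growth_rate N * (2 / (real N + 1) * (0 + ?A)))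
        = growth_rate N * (2 / (real N + 1)) * (- h)" by (simp add: algebra_simps)
    also have "growth_rate N * (2 / (real N + 1)) = (real N + 1) / real N * beta N"
      using N by (simp add: growth_rate_def beta_def power2_eq_square divide_simps)
    finally show ?thesis .
  qed
  ultimately show ?thesis by (simp only:)
qed

end

theorem proposition5p3:
  fixes N d :: nat and \<kappa> :: "real \<Rightarrow> real"
  assumes "N \<ge> 2" and "d \<ge> 1" and "rho_c N d < 2"
    and kappa: "\<forall>\<^sub>F \<rho> in at_right (rho_c N d). 0 < \<kappa> \<rho> \<and> \<kappa> \<rho> < \<rho> - rho_c N d"
    and subcritical: "\<forall>\<^sub>F \<rho> in at_right (rho_c N d).
      real N * (alpha0 d \<rho> (\<kappa> \<rho>) + \<rho>) > alpha0 d \<rho> (\<kappa> \<rho>)"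
  shows "(\<lambda>\<rho>. measure_pmf.expectation (unif_neg N d \<rho> (\<kappa> \<rho>)) (hom d \<rho> (\<kappa> \<rho>)))
           \<in> O[at_right (rho_c N d)](\<lambda>\<rho>. \<rho> - rho_c N d)
       \<and> (\<lambda>\<rho>. measure_pmf.variance (unif_neg N d \<rho> (\<kappa> \<rho>)) (hom d \<rho> (\<kappa> \<rho>)))
           \<in> O[at_right (rho_c N d)](\<lambda>\<rho>. (\<rho> - rho_c N d)\<^sup>2)
       \<and> (\<kappa> \<in> o[at_right (rho_c N d)](\<lambda>\<rho>. \<rho> - rho_c N d) \<longrightarrow>
           (\<forall>h. (\<forall>\<^sub>F \<rho> in at_right (rho_c N d). h \<in> {alpha0 d \<rho> (\<kappa> \<rho>)..0}) \<longrightarrow>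
             ((\<lambda>\<rho>. - ((\<rho> - rho_c N d) *
                  ln (measure_pmf.prob (unif_neg N d \<rho> (\<kappa> \<rho>)) {\<tau>. hom d \<rho> (\<kappa> \<rho>) \<tau> \<le> h})))
               \<longlongrightarrow> (real N + 1) / real N * beta N * (- h)) (at_right (rho_c N d))))"
  using expectation_variance_bigo[OF assms(1,2) kappa subcritical]
    large_deviation[OF assms(1,2) kappa subcritical] by blast

end
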